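(* For $t\ge 1$ let $L_t$ be the closure of the $4$-strand braid word $(\sigma_1\sigma_3\sigma_2^4)^t\sigma_1\sigma_3$, and let $n(L_t)$ be the number of crossings of this diagram. For every $k\ge 0$ there exists $\varepsilon>0$ such that $$\liminf_{t\to\infty}\left(\frac{\operatorname{rank}\big(\operatorname{Kh}^{n(L_t)-k,*}(L_t)\big)}{\binom{n(L_t)}{n(L_t)-k}}\right)\ge\varepsilon .$$
   Context: $\operatorname{Kh}^{i,j}(L)$ denotes integral Khovanov homology with homological degree $i$ and quantum degree $j$, and $\operatorname{Kh}^{i,*}(L)=\bigoplus_j\operatorname{Kh}^{i,j}(L)$. The convention is that the generators $\sigma_i$ give positive crossings (strands oriented in parallel), so that the Khovanov homology of the closure of a positive braid word with $n$ letters is supported in homological degrees $[0,n]$. The diagram $L_t$ has $n(L_t)=6t+2$ crossings. *)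

theory Defs
  imports
    "HOL-Algebra.Algebra"
    "HOL-Library.Extended_Real"
    "HOL-Library.Liminf_Limsup"
begin

section \<open>Resolutions of the closure of a braid word\<close>

text \<open>
  A braid word on \<open>b\<close> strands is a list \<open>w\<close> of nonzero integers of absolute value less than \<open>b\<close>;
  the letter \<open>i > 0\<close> is the generator \<open>\<sigma>\<^sub>i\<close>, the letter \<open>- i\<close> its inverse.
  All strands of the braid are oriented in parallel, and the convention is that \<open>\<sigma>\<^sub>i\<close> is a positive
  crossing. The crossings of the diagram of the closure are the positions \<open>p < length w\<close>.

  The point \<open>(p, s)\<close> lies on strand position \<open>s \<in> {1..b}\<close> just before the \<open>p\<close>-th letter (so just
  after the \<open>p - 1\<close>-st); the closure connects \<open>(length w, s)\<close> to \<open>(0, s)\<close>.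
\<close>

type_synonym point = "nat \<times> nat"

definition left_strand :: "int list \<Rightarrow> nat \<Rightarrow> nat" where
  "left_strand w p = nat \<bar>w ! p\<bar>"

definition points :: "nat \<Rightarrow> int list \<Rightarrow> point set" where
  "points b w = {0..length w} \<times> {1..b}"

text \<open>
  A vertex of the cube of resolutions is the set \<open>\<rho>\<close> of the crossings that get the 1-smoothing.
  The 0-smoothing of a positive crossing and the 1-smoothing of a negative crossing are the ones
  compatible with the orientation, that is, two parallel vertical arcs; the other smoothing of a
  crossing between the positions \<open>i\<close> and \<open>i + 1\<close> consists of a cap and a cup.
\<close>

definition vertical_smoothing :: "int list \<Rightarrow> nat set \<Rightarrow> nat \<Rightarrow> bool" where
  "vertical_smoothing w \<rho> p \<longleftrightarrow> (if w ! p > 0 then p \<notin> \<rho> else p \<in> \<rho>)"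

inductive arc :: "nat \<Rightarrow> int list \<Rightarrow> nat set \<Rightarrow> point \<Rightarrow> point \<Rightarrow> bool"
  for b :: nat and w :: "int list" and \<rho> :: "nat set" where
  closure: "s \<in> {1..b} \<Longrightarrow> arc b w \<rho> (length w, s) (0, s)"
| passing: "\<lbrakk>p < length w; s \<in> {1..b}; s \<noteq> left_strand w p; s \<noteq> left_strand w p + 1\<rbrakk>
    \<Longrightarrow> arc b w \<rho> (p, s) (p + 1, s)"
| vertical: "\<lbrakk>p < length w; vertical_smoothing w \<rho> p; s = left_strand w p \<or> s = left_strand w p + 1\<rbrakk>
    \<Longrightarrow> arc b w \<rho> (p, s) (p + 1, s)"
| horizontal: "\<lbrakk>p < length w; \<not> vertical_smoothing w \<rho> p; q = p \<or> q = p + 1\<rbrakk>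
    \<Longrightarrow> arc b w \<rho> (q, left_strand w p) (q, left_strand w p + 1)"

text \<open>A circle of a resolution is represented by the set of the points it passes through.\<close>

definition circles :: "nat \<Rightarrow> int list \<Rightarrow> nat set \<Rightarrow> point set set" where
  "circles b w \<rho> = (\<lambda>x. {y. equivclp (arc b w \<rho>) x y}) ` points b w"

section \<open>The Khovanov complex\<close>

text \<open>
  With \<open>V\<close> the free abelian group on \<open>v\<^sub>+\<close> and \<open>v\<^sub>-\<close>, the summand of the Khovanov complex at the vertex
  \<open>\<rho>\<close> is the tensor product of one copy of \<open>V\<close> for each circle. Its basis element
  with \<open>v\<^sub>+\<close> at the circles in \<open>P\<close> and \<open>v\<^sub>-\<close> at the other circles is represented by the pair \<open>(\<rho>, P)\<close>.
\<close>

type_synonym state = "nat set \<times> point set set"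

definition states :: "nat \<Rightarrow> int list \<Rightarrow> state set" where
  "states b w = {(\<rho>, P). \<rho> \<subseteq> {..<length w} \<and> P \<subseteq> circles b w \<rho>}"

definition n_pos :: "int list \<Rightarrow> nat" where
  "n_pos w = card {p. p < length w \<and> w ! p > 0}"

definition n_neg :: "int list \<Rightarrow> nat" where
  "n_neg w = card {p. p < length w \<and> w ! p < 0}"

fun homological_degree :: "int list \<Rightarrow> state \<Rightarrow> int" where
  "homological_degree w (\<rho>, P) = int (card \<rho>) - int (n_neg w)"

text \<open>Here \<open>v\<^sub>+\<close> has degree 1 and \<open>v\<^sub>-\<close> has degree \<open>- 1\<close>.\<close>

fun quantum_degree :: "nat \<Rightarrow> int list \<Rightarrow> state \<Rightarrow> int" where
  "quantum_degree b w (\<rho>, P) =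
     int (card P) - int (card (circles b w \<rho> - P)) + int (card \<rho>) + int (n_pos w) - 2 * int (n_neg w)"

definition chain_group :: "nat \<Rightarrow> int list \<Rightarrow> int \<Rightarrow> int \<Rightarrow> (state \<Rightarrow>\<^sub>0 int) monoid" where
  "chain_group b w i j =
     free_Abelian_group {x \<in> states b w. homological_degree w x = i \<and> quantum_degree b w x = j}"

text \<open>
  The map along the edge of the cube from \<open>\<rho>\<close> to \<open>insert p \<rho>\<close>, without its sign. The circles \<open>A\<close> of the
  first resolution are replaced by the circles \<open>B\<close> of the second. If two circles merge, the map is
  \<open>v\<^sub>+ \<otimes> v\<^sub>+ \<mapsto> v\<^sub>+\<close>, \<open>v\<^sub>+ \<otimes> v\<^sub>- \<mapsto> v\<^sub>-\<close>, \<open>v\<^sub>- \<otimes> v\<^sub>+ \<mapsto> v\<^sub>-\<close>, \<open>v\<^sub>- \<otimes> v\<^sub>- \<mapsto> 0\<close>; if one circle splits, it is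
  \<open>v\<^sub>+ \<mapsto> v\<^sub>+ \<otimes> v\<^sub>- + v\<^sub>- \<otimes> v\<^sub>+\<close>, \<open>v\<^sub>- \<mapsto> v\<^sub>- \<otimes> v\<^sub>-\<close>. These are the only two cases for a planar diagram.
\<close>

definition edge_map :: "nat \<Rightarrow> int list \<Rightarrow> nat \<Rightarrow> state \<Rightarrow> (state \<Rightarrow>\<^sub>0 int)" where
  "edge_map b w p = (\<lambda>(\<rho>, P).
     let \<rho>' = insert p \<rho>;
         A = circles b w \<rho> - circles b w \<rho>';
         B = circles b w \<rho>' - circles b w \<rho>
     in if card A = 2 then
          (if A \<subseteq> P then frag_of (\<rho>', (P - A) \<union> B)
           else if A \<inter> P = {} then 0
           else frag_of (\<rho>', P - A))
        else
          (if A \<subseteq> P then (\<Sum>c\<in>B. frag_of (\<rho>', insert c (P - A)))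
           else frag_of (\<rho>', P)))"

definition state_differential :: "nat \<Rightarrow> int list \<Rightarrow> state \<Rightarrow> (state \<Rightarrow>\<^sub>0 int)" where
  "state_differential b w x =
     (\<Sum>p\<in>{..<length w} - fst x. frag_cmul ((-1) ^ card {q \<in> fst x. q < p}) (edge_map b w p x))"

definition differential :: "nat \<Rightarrow> int list \<Rightarrow> (state \<Rightarrow>\<^sub>0 int) \<Rightarrow> (state \<Rightarrow>\<^sub>0 int)" where
  "differential b w = frag_extend (state_differential b w)"

section \<open>Khovanov homology and its rank\<close>

definition cycle_group :: "nat \<Rightarrow> int list \<Rightarrow> int \<Rightarrow> int \<Rightarrow> (state \<Rightarrow>\<^sub>0 int) monoid" where
  "cycle_group b w i j =
     subgroup_generated (chain_group b w i j)
       (kernel (chain_group b w i j) (chain_group b w (i + 1) j) (differential b w))"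

definition boundaries :: "nat \<Rightarrow> int list \<Rightarrow> int \<Rightarrow> int \<Rightarrow> (state \<Rightarrow>\<^sub>0 int) set" where
  "boundaries b w i j = differential b w ` carrier (chain_group b w (i - 1) j)"

definition Kh :: "nat \<Rightarrow> int list \<Rightarrow> int \<Rightarrow> int \<Rightarrow> (state \<Rightarrow>\<^sub>0 int) set monoid" where
  "Kh b w i j = cycle_group b w i j Mod boundaries b w i j"

definition Kh_total :: "nat \<Rightarrow> int list \<Rightarrow> int \<Rightarrow> (int \<Rightarrow> (state \<Rightarrow>\<^sub>0 int) set) monoid" where
  "Kh_total b w i = sum_group UNIV (Kh b w i)"

definition Z_independent :: "('a, 'm) monoid_scheme \<Rightarrow> 'a set \<Rightarrow> bool" where
  "Z_independent G S \<longleftrightarrow>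
     (\<forall>c :: 'a \<Rightarrow> int. finprod G (\<lambda>s. s [^]\<^bsub>G\<^esub> c s) S = \<one>\<^bsub>G\<^esub> \<longrightarrow> (\<forall>s\<in>S. c s = 0))"

text \<open>
  The rank of an abelian group. The supremum is taken in \<open>nat\<close>, so the value is meaningful only for
  groups of finite rank, such as the finitely generated ones.
\<close>

definition abelian_rank :: "('a, 'm) monoid_scheme \<Rightarrow> nat" where
  "abelian_rank G = Sup {card S | S. finite S \<and> S \<subseteq> carrier G \<and> Z_independent G S}"

section \<open>The family of braid words\<close>

definition L_word :: "nat \<Rightarrow> int list" where
  "L_word t = concat (replicate t [1, 3, 2, 2, 2, 2]) @ [1, 3]"

end

theory Submission
  imports Defs
begin

text \<open>
  Let \<open>n = 6 t + 2\<close>. In the resolution with only 1-smoothings the circles are the vertices of a graph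
  whose edges are the crossings, and in each of the \<open>t\<close> blocks the four crossings of \<open>\<sigma>\<^sub>2\<^sup>4\<close> form a
  4-cycle. Choose a set \<open>S\<close> of \<open>k\<close> blocks. For each way \<open>c\<close> of choosing one crossing of \<open>\<sigma>\<^sub>2\<^sup>4\<close> in every
  block of \<open>S\<close>, give 0-smoothings to the chosen crossings only and label all circles by \<open>v\<^sub>+\<close>; let
  \<open>z\<^sub>S\<close> be the sum of these states over all \<open>c\<close>. Since the chosen crossings are a forest in the
  graph, changing one of them back splits a circle into its two ends \<open>u\<close>, \<open>v\<close>, which yields the state
  with \<open>v\<^sub>-\<close> at \<open>u\<close> plus the state with \<open>v\<^sub>-\<close> at \<open>v\<close>. Along a 4-cycle the signs alternate, so these
  terms cancel and \<open>z\<^sub>S\<close> is a cycle of homological degree \<open>n - k\<close>.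

  A chosen set together with one further crossing is still a forest. Hence every edge of the cube
  into such a resolution is a split, and a split never produces a state with \<open>v\<^sub>+\<close> everywhere. So the
  coefficient of such a state vanishes on all boundaries, and these coefficients separate the
  classes of the \<open>z\<^sub>S\<close>. The rank is therefore at least \<open>t choose k\<close>, which is of the order of
  \<open>n choose k\<close>.
\<close>

section \<open>Merging two circles of a resolution\<close>

lemma even_card_involution:
  assumes "finite A" and "\<And>x. x \<in> A \<Longrightarrow> f x \<in> A"
    and "\<And>x. x \<in> A \<Longrightarrow> f (f x) = x" and "\<And>x. x \<in> A \<Longrightarrow> f x \<noteq> x"
  shows "even (card A)"
  using assms
proof (induction A rule: finite_psubset_induct)
  case (psubset A)
  show ?case
  proof (cases "A = {}")
    case False
    then obtain x where x: "x \<in> A" by blast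
    let ?Y = "A - {x, f x}"
    have "even (card ?Y)"
    proof (rule psubset.IH)
      show "?Y \<subset> A" using x by blast
      show "f y \<in> ?Y" if "y \<in> ?Y" for y
        using that x psubset.prems by (metis Diff_iff insert_iff singletonD)
    qed (use psubset.prems in auto)
    moreover have "card A = card ?Y + 2"
    proof -
      have "card {x, f x} = 2" using psubset.prems(3)[OF x] by (simp add: eq_commute)
      moreover have "{x, f x} \<subseteq> A" using x psubset.prems by blast
      ultimately show ?thesis
        using psubset.hyps card_Diff_subset[of "{x, f x}" A] card_mono[of A "{x, f x}"] by simp
    qed
    ultimately show ?thesis by simp
  qed simp
qed

section \<open>Circles as equivalence classes of points\<close>

definition circle_of :: "nat \<Rightarrow> int list \<Rightarrow> nat set \<Rightarrow> point \<Rightarrow> point set" where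
  "circle_of b w \<rho> x = {y. equivclp (arc b w \<rho>) x y}"

lemma circles_eq: "circles b w \<rho> = circle_of b w \<rho> ` points b w"
  by (simp add: circles_def circle_of_def)

lemma finite_circles: "finite (circles b w \<rho>)"
  by (simp add: circles_def points_def)

lemma equivclp_transitive:
  "equivclp r x y \<Longrightarrow> equivclp r y z \<Longrightarrow> equivclp r x z"
  by (metis equivp_evquivclp equivp_transp)

lemma circle_of_eq_iff: "circle_of b w \<rho> x = circle_of b w \<rho> y \<longleftrightarrow> equivclp (arc b w \<rho>) x y"
  unfolding circle_of_def using equivp_evquivclp[of "arc b w \<rho>"]
  by (metis (mono_tags, lifting) Collect_cong equivclp_sym equivclp_transitive equivp_reflp mem_Collect_eq)

lemma mem_circle_of_iff: "y \<in> circle_of b w \<rho> x \<longleftrightarrow> equivclp (arc b w \<rho>) x y"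
  by (simp add: circle_of_def)

text \<open>
  Every point has two sides, \<open>False\<close> towards the preceding and \<open>True\<close> towards the following
  letter; the arcs of a resolution form a perfect matching of the pairs of a point and a side.
\<close>

definition straight :: "int list \<Rightarrow> nat set \<Rightarrow> nat \<Rightarrow> nat \<Rightarrow> bool" where
  "straight w \<rho> p s \<longleftrightarrow>
     vertical_smoothing w \<rho> p \<or> s \<noteq> left_strand w p \<and> s \<noteq> left_strand w p + 1"

fun mate :: "int list \<Rightarrow> nat set \<Rightarrow> point \<times> bool \<Rightarrow> point \<times> bool" where
  "mate w \<rho> ((q, s), True) =
     (if q = length w then ((0, s), False)
      else if straight w \<rho> q s then ((q + 1, s), False)
      else ((q, 2 * left_strand w q + 1 - s), True))"
| "mate w \<rho> ((q, s), False) =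
     (if q = 0 then ((length w, s), True)
      else if straight w \<rho> (q - 1) s then ((q - 1, s), True)
      else ((q, 2 * left_strand w (q - 1) + 1 - s), False))"

text \<open>The four ends of the crossing \<open>p\<close>, each seen from its adjacent point.
  Either smoothing of \<open>p\<close> joins these ends among themselves, so the matching preserves
  both this set and its complement.\<close>

fun sides_at :: "int list \<Rightarrow> nat \<Rightarrow> point \<times> bool \<Rightarrow> bool" where
  "sides_at w p ((q, s), d) \<longleftrightarrow>
     (s = left_strand w p \<or> s = left_strand w p + 1) \<and> (if d then q = p else q = p + 1)"

locale braid_word =
  fixes b :: nat and w :: "int list"
  assumes left_strand_pos: "p < length w \<Longrightarrow> 0 < left_strand w p"
    and left_strand_less: "p < length w \<Longrightarrow> left_strand w p < b"
begin

lemma mate_closed: "fst h \<in> points b w \<Longrightarrow> fst (mate w \<rho> h) \<in> points b w"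
proof -
  assume h: "fst h \<in> points b w"
  obtain q s d where [simp]: "h = ((q, s), d)" by (metis surj_pair)
  have "q \<le> length w" "s \<in> {1..b}" using h by (auto simp: points_def)
  then show ?thesis
    using left_strand_pos[of q] left_strand_less[of q]
      left_strand_pos[of "q - 1"] left_strand_less[of "q - 1"]
    by (cases d; cases q) (auto simp: points_def straight_def Suc_le_eq)
qed

text \<open>Closure arcs and straight arcs run between opposite sides and are undone by the rule for
  the other side; \<open>2 * left_strand w q + 1 - s\<close> reflects one strand of the crossing
  onto the other, which undoes itself.\<close>

lemma mate_mate: "fst h \<in> points b w \<Longrightarrow> mate w \<rho> (mate w \<rho> h) = h"
  by (cases "(w, \<rho>, h)" rule: mate.cases) (auto simp: points_def straight_def)

lemma mate_neq: "fst h \<in> points b w \<Longrightarrow> mate w \<rho> h \<noteq> h"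
  by (cases "(w, \<rho>, h)" rule: mate.cases) (auto simp: points_def straight_def)

lemma sides_at_mate:
  "fst h \<in> points b w \<Longrightarrow> p < length w \<Longrightarrow> sides_at w p (mate w \<rho> h) \<longleftrightarrow> sides_at w p h"
  by (cases "(w, \<rho>, h)" rule: mate.cases) (auto simp: points_def straight_def)

lemma arc_points: "arc b w \<rho> x y \<Longrightarrow> x \<in> points b w \<and> y \<in> points b w"
proof (induction rule: arc.induct)
  case (vertical p s)
  then show ?case using left_strand_pos[of p] left_strand_less[of p] by (auto simp: points_def)
next
  case (horizontal p q)
  then show ?case using left_strand_pos[of p] left_strand_less[of p] by (auto simp: points_def)
qed (auto simp: points_def)

text \<open>Together with \<open>mate_imp_arc\<close> this lets circles be studied through the
  matching, although \<open>arc\<close> lists every arc in one direction only.\<close>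

lemma arc_imp_mate: "arc b w \<rho> x y \<Longrightarrow> \<exists>d d'. mate w \<rho> (x, d) = (y, d')"
proof (induction rule: arc.induct)
  case (closure s)
  have "mate w \<rho> ((length w, s), True) = ((0, s), False)" by simp
  then show ?case by blast
next
  case (passing p s)
  then have "mate w \<rho> ((p, s), True) = ((p + 1, s), False)" by (simp add: straight_def)
  then show ?case by blast
next
  case (vertical p s)
  then have "mate w \<rho> ((p, s), True) = ((p + 1, s), False)" by (simp add: straight_def)
  then show ?case by blast
next
  case (horizontal p q)
  let ?i = "left_strand w p"
  from horizontal have "mate w \<rho> ((q, ?i), q = p) = ((q, ?i + 1), q = p)"
    by (auto simp: straight_def)
  then show ?case by blast
qed

lemma mate_imp_arc:
  assumes "x \<in> points b w" "mate w \<rho> (x, d) = (y, d')"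
  shows "arc b w \<rho> x y \<or> arc b w \<rho> y x"
proof -
  obtain q s where x: "x = (q, s)" by fastforce
  with assms have q: "q \<le> length w" and s: "s \<in> {1..b}" by (auto simp: points_def)
  show ?thesis
  proof (cases d)
    case True
    show ?thesis
    proof (cases "q = length w")
      case True
      then show ?thesis using assms x s \<open>d\<close> by (auto intro: arc.intros)
    next
      case False
      then have "q < length w" using q by simp
      then show ?thesis
        using False assms x s \<open>d\<close> arc.passing[of q w s b \<rho>] arc.vertical[of q w \<rho> s b]
          arc.horizontal[of q w \<rho> q b]
        by (auto simp: straight_def split: if_splits)
    qed
  next
    case False
    show ?thesis
    proof (cases q)
      case 0
      then show ?thesis using assms x s \<open>\<not> d\<close> by (auto intro: arc.intros)
    next
      case (Suc p)
      then have "p < length w" using q by simp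
      then show ?thesis
        using Suc assms x s \<open>\<not> d\<close> arc.passing[of p w s b \<rho>] arc.vertical[of p w \<rho> s b]
          arc.horizontal[of p w \<rho> q b]
        by (auto simp: straight_def split: if_splits)
    qed
  qed
qed

text \<open>What is left of the resolution after erasing the two arcs at the crossing
  \<open>p\<close>. Both smoothings of \<open>p\<close> share this relation, so it serves to compare
  them.\<close>

definition away_arc :: "nat set \<Rightarrow> nat \<Rightarrow> point \<Rightarrow> point \<Rightarrow> bool" where
  "away_arc \<rho> p x y \<longleftrightarrow> x \<in> points b w \<and> (\<exists>d d'. \<not> sides_at w p (x, d) \<and> mate w \<rho> (x, d) = (y, d'))"

lemma away_arc_sym:
  assumes "p < length w" "away_arc \<rho> p x y" shows "away_arc \<rho> p y x"
proof -
  from assms(2) obtain d d' where d: "x \<in> points b w" "\<not> sides_at w p (x, d)" "mate w \<rho> (x, d) = (y, d')"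
    unfolding away_arc_def by blast
  then have "y \<in> points b w" "\<not> sides_at w p (y, d')" "mate w \<rho> (y, d') = (x, d)"
    using mate_closed[of "(x, d)" \<rho>] sides_at_mate[of "(x, d)" p \<rho>] mate_mate[of "(x, d)" \<rho>] assms(1)
    by simp_all
  then show ?thesis unfolding away_arc_def by blast
qed

lemma away_arc_imp_arc: "away_arc \<rho> p x y \<Longrightarrow> equivclp (arc b w \<rho>) x y"
  unfolding away_arc_def using mate_imp_arc by (meson equivclp_sym r_into_equivclp)

lemma away_arc_cong:
  assumes "\<And>q. q < length w \<Longrightarrow> q \<noteq> p \<Longrightarrow> vertical_smoothing w \<rho>' q = vertical_smoothing w \<rho> q"
  shows "away_arc \<rho>' p x y = away_arc \<rho> p x y"
proof -
  have straight: "straight w \<rho>' q s = straight w \<rho> q s"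
    if "q < length w" "q \<noteq> p \<or> s \<noteq> left_strand w p \<and> s \<noteq> left_strand w p + 1" for q s
    using that assms unfolding straight_def by blast
  have "mate w \<rho>' (x, d) = mate w \<rho> (x, d)" if x: "x \<in> points b w" "\<not> sides_at w p (x, d)" for d
  proof -
    obtain q s where [simp]: "x = (q, s)" by fastforce
    have "q \<le> length w" using x by (simp add: points_def)
    moreover have "straight w \<rho>' q s = straight w \<rho> q s" if d "q \<noteq> length w"
      using x that calculation by (intro straight) auto
    moreover have "straight w \<rho>' (q - 1) s = straight w \<rho> (q - 1) s" if "\<not> d" "q \<noteq> 0"
      using x that calculation(1) by (intro straight) auto
    ultimately show ?thesis by (cases d) simp_all
  qed
  then show ?thesis unfolding away_arc_def by metis
qed

text \<open>
  A parity argument: the matching pairs off all sides of points in the component of one end of a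
  horizontal arc after that arc is removed, except for the sides at the crossing, so an even
  number of the latter lie in the component.
\<close>

lemma horizontal_ends_away:
  assumes p: "p < length w" and horiz: "\<not> vertical_smoothing w \<rho> p" and q: "q = p \<or> q = p + 1"
    and apart: "\<not> equivclp (arc b w \<rho>) (p, left_strand w p) (p + 1, left_strand w p)"
  shows "equivclp (away_arc \<rho> p) (q, left_strand w p) (q, left_strand w p + 1)"
proof (rule ccontr)
  let ?i = "left_strand w p" and ?E = "equivclp (arc b w \<rho>)"
  assume contra: "\<not> equivclp (away_arc \<rho> p) (q, ?i) (q, ?i + 1)"
  define C where "C = {z. equivclp (away_arc \<rho> p) (q, ?i) z}"
  have C_E: "?E (q, ?i) z" if "z \<in> C" for z
  proof -
    have "equivclp (away_arc \<rho> p) (q, ?i) z" using that by (simp add: C_def)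
    then show ?thesis
    proof (induction rule: equivclp_induct)
      case (step y z)
      then show ?case by (meson away_arc_imp_arc equivclp_sym equivclp_transitive)
    qed simp
  qed
  have C_points: "z \<in> points b w" if "z \<in> C" for z
  proof -
    have "equivclp (away_arc \<rho> p) (q, ?i) z" using that by (simp add: C_def)
    then show ?thesis
    proof (induction rule: equivclp_induct)
      case base
      then show ?case
        using p q left_strand_pos[of p] left_strand_less[of p] by (auto simp: points_def)
    next
      case (step y z)
      then show ?case using away_arc_sym[OF p] unfolding away_arc_def by blast
    qed
  qed
  have C_step: "z \<in> C" if "y \<in> C" "away_arc \<rho> p y z" for y z
    using that unfolding C_def by (auto intro: equivclp_into_equivclp)
  have "finite C"
    using C_points by (intro finite_subset[of C "points b w"]) (auto simp: points_def)
  have caps: "?E (r, ?i) (r, ?i + 1)" if "r = p \<or> r = p + 1" for r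
    using arc.horizontal[OF p horiz that] by (rule r_into_equivclp)
  \<comment> \<open>If \<open>C\<close> reached the far end of the crossing, the cap or cup there
    would connect the two circles, against \<open>apart\<close>.\<close>
  have other: "(if q = p then p + 1 else p, s) \<notin> C" if "s = ?i \<or> s = ?i + 1" for s
  proof
    assume "(if q = p then p + 1 else p, s) \<in> C"
    then have "?E (q, ?i) (if q = p then p + 1 else p, s)" by (rule C_E)
    moreover have "?E (if q = p then p + 1 else p, s) (if q = p then p + 1 else p, ?i)"
    proof (cases "s = ?i")
      case False
      then have "s = ?i + 1" using that by blast
      then show ?thesis using caps[of "if q = p then p + 1 else p"] by (simp add: equivclp_sym)
    qed simp
    ultimately have "?E (q, ?i) (if q = p then p + 1 else p, ?i)" by (rule equivclp_transitive)
    then show False using apart q equivclp_sym[of "arc b w \<rho>" "(q, ?i)"] by (cases "q = p") auto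
  qed
  define D where "D = {h \<in> C \<times> UNIV. \<not> sides_at w p h}"
  have "even (card D)"
  proof (rule even_card_involution[where f = "mate w \<rho>"])
    show "finite D" using \<open>finite C\<close> by (auto simp: D_def)
    fix h assume h: "h \<in> D"
    then have hp: "fst h \<in> points b w" using C_points by (auto simp: D_def)
    show "mate w \<rho> (mate w \<rho> h) = h" "mate w \<rho> h \<noteq> h"
      using hp by (rule mate_mate, rule mate_neq)
    have "away_arc \<rho> p (fst h) (fst (mate w \<rho> h))"
      unfolding away_arc_def using h hp by (metis (no_types, lifting) D_def mem_Collect_eq prod.collapse)
    moreover have "fst h \<in> C" using h by (simp add: D_def mem_Times_iff)
    ultimately have "fst (mate w \<rho> h) \<in> C" using C_step by blast
    moreover have "\<not> sides_at w p (mate w \<rho> h)"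
      using h hp p sides_at_mate by (simp add: D_def)
    ultimately show "mate w \<rho> h \<in> D" by (simp add: D_def mem_Times_iff)
  qed
  \<comment> \<open>Of the four sides at the crossing, only that of the starting point lies over
    \<open>C\<close>. Adding it to \<open>D\<close> makes the number of sides over \<open>C\<close>
    odd, whereas it is twice \<open>card C\<close>.\<close>
  moreover have "C \<times> UNIV = insert ((q, ?i), q = p) D"
  proof -
    have far: "(q, ?i + 1) \<notin> C" using contra by (simp add: C_def)
    have only: "h = ((q, ?i), q = p)" if "fst h \<in> C" "sides_at w p h" for h
    proof -
      obtain r s d where h: "h = ((r, s), d)" by (metis surj_pair)
      have s: "s = ?i \<or> s = ?i + 1" and r: "r = (if d then p else p + 1)"
        using that(2) h by (auto split: if_splits)
      have "r = q"
        using other[OF s] that(1) h r q by (metis fst_conv)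
      then show ?thesis using that far s r h by (cases d) auto
    qed
    have near: "(q, ?i) \<in> C" by (simp add: C_def)
    show ?thesis
    proof (intro equalityI subsetI)
      fix h assume "h \<in> C \<times> (UNIV :: bool set)"
      then have "fst h \<in> C" by (simp add: mem_Times_iff)
      then show "h \<in> insert ((q, ?i), q = p) D"
        using only[of h] by (cases "sides_at w p h") (simp_all add: D_def mem_Times_iff)
    qed (use near in \<open>auto simp: D_def\<close>)
  qed
  moreover have "((q, ?i), q = p) \<notin> D" using q by (auto simp: D_def)
  moreover have "finite D" using \<open>finite C\<close> by (auto simp: D_def)
  ultimately have "odd (card (C \<times> (UNIV :: bool set)))" by simp
  then show False by (simp add: card_cartesian_product)
qed

text \<open>As the cap and the cup lie on different circles, each can be replaced by the detour
  along the rest of its circle (\<open>horizontal_ends_away\<close>), which survives in the new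
  resolution. So the old relation is contained in the new one, and the two vertical arcs add nothing
  but a link between the two circles.\<close>

lemma circle_of_merge:
  assumes p: "p < length w" and horiz: "\<not> vertical_smoothing w \<rho> p"
    and vert: "vertical_smoothing w \<rho>' p"
    and same: "\<And>q. q < length w \<Longrightarrow> q \<noteq> p \<Longrightarrow> vertical_smoothing w \<rho>' q = vertical_smoothing w \<rho> q"
    and apart: "circle_of b w \<rho> (p, left_strand w p) \<noteq> circle_of b w \<rho> (p + 1, left_strand w p)"
  defines "m \<equiv> circle_of b w \<rho> (p, left_strand w p) \<union> circle_of b w \<rho> (p + 1, left_strand w p)"
  shows "circle_of b w \<rho>' z = (if z \<in> m then m else circle_of b w \<rho> z)"
proof -
  let ?i = "left_strand w p" and ?E = "equivclp (arc b w \<rho>)" and ?E' = "equivclp (arc b w \<rho>')"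
  have apart': "\<not> ?E (p, ?i) (p + 1, ?i)" using apart by (simp add: circle_of_eq_iff)
  have m: "z \<in> m \<longleftrightarrow> ?E (p, ?i) z \<or> ?E (p + 1, ?i) z" for z
    by (simp add: m_def mem_circle_of_iff)
  have caps: "?E (r, ?i) (r, ?i + 1)" if "r = p \<or> r = p + 1" for r
    using arc.horizontal[OF p horiz that] by (rule r_into_equivclp)
  have legs: "?E' (p, s) (p + 1, s)" if "s = ?i \<or> s = ?i + 1" for s
    using arc.vertical[OF p vert that] by (rule r_into_equivclp)
  have away_E': "equivclp (away_arc \<rho> p) x y \<Longrightarrow> ?E' x y" for x y
  proof (induction rule: equivclp_induct)
    case (step y z)
    then have "?E' y z"
      using away_arc_cong[OF same] away_arc_imp_arc by (metis equivclp_sym)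
    then show ?case using step by (meson equivclp_transitive)
  qed simp
  have E_away: "?E x y \<Longrightarrow> equivclp (away_arc \<rho> p) x y" for x y
  proof (induction rule: equivclp_induct)
    case (step y z)
    have "equivclp (away_arc \<rho> p) y z" if yz: "arc b w \<rho> y z" for y z
    proof -
      obtain d d' where d: "mate w \<rho> (y, d) = (z, d')" using arc_imp_mate[OF yz] by blast
      show ?thesis
      proof (cases "sides_at w p (y, d)")
        case False
        then have "away_arc \<rho> p y z" using d arc_points[OF yz] unfolding away_arc_def by blast
        then show ?thesis by (rule r_into_equivclp)
      next
        case True
        obtain q s where y: "y = (q, s)" by fastforce
        have q: "q = p \<or> q = p + 1" and s: "s = ?i \<or> s = ?i + 1"
          using True y by (auto split: if_splits)
        have "z = (q, 2 * ?i + 1 - s)"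
          using True d y horiz p by (cases d) (auto simp: straight_def)
        then have "y = (q, ?i) \<and> z = (q, ?i + 1) \<or> y = (q, ?i + 1) \<and> z = (q, ?i)"
          using s y by auto
        then show ?thesis
          using horizontal_ends_away[OF p horiz q apart'] equivclp_sym by metis
      qed
    qed
    then have "equivclp (away_arc \<rho> p) y z" using step.hyps(2) by (metis equivclp_sym)
    then show ?case using step.IH by (meson equivclp_transitive)
  qed simp
  have E_E': "?E x y \<Longrightarrow> ?E' x y" for x y using E_away away_E' by blast
  have m_E': "?E' (p, ?i) x" if "x \<in> m" for x
    using that legs[of ?i] E_E' by (metis equivclp_transitive m)
  have m_E: "y \<in> m" if "x \<in> m" "?E x y" for x y
    using that equivclp_transitive m by metis
  have "?E' x y \<longleftrightarrow> ?E x y \<or> x \<in> m \<and> y \<in> m" for x y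
  proof
    assume "?E' x y"
    then show "?E x y \<or> x \<in> m \<and> y \<in> m"
    proof (induction rule: equivclp_induct)
      case (step y z)
      have *: "?E y z \<or> y \<in> m \<and> z \<in> m" if yz: "arc b w \<rho>' y z" for y z
      proof -
        obtain d d' where d: "mate w \<rho>' (y, d) = (z, d')" using arc_imp_mate[OF yz] by blast
        show ?thesis
        proof (cases "sides_at w p (y, d)")
          case False
          then have "away_arc \<rho>' p y z" using d arc_points[OF yz] unfolding away_arc_def by blast
          then show ?thesis using away_arc_cong[OF same] away_arc_imp_arc by blast
        next
          case True
          obtain q s where y: "y = (q, s)" by fastforce
          have q: "q = p \<or> q = p + 1" and s: "s = ?i \<or> s = ?i + 1"
            using True y by (auto split: if_splits)
          have "z = (if q = p then p + 1 else p, s)"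
            using True d y vert p by (cases d) (auto simp: straight_def)
          then have "y = (p, s) \<and> z = (p + 1, s) \<or> y = (p + 1, s) \<and> z = (p, s)"
            using q y by auto
          moreover have "(p, s) \<in> m" "(p + 1, s) \<in> m"
            using s caps m by auto
          ultimately show ?thesis by blast
        qed
      qed
      have "?E y z \<or> y \<in> m \<and> z \<in> m"
        using * step.hyps(2) by (metis equivclp_sym)
      then show ?case
      proof
        assume "?E y z"
        then show ?thesis using step.IH m_E equivclp_transitive[of _ x y z] by blast
      next
        assume "y \<in> m \<and> z \<in> m"
        then show ?thesis using step.IH m_E equivclp_sym[of _ x y] by blast
      qed
    qed simp
  next
    assume "?E x y \<or> x \<in> m \<and> y \<in> m"
    then show "?E' x y" using E_E' m_E' by (meson equivclp_sym equivclp_transitive)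
  qed
  then have eq: "circle_of b w \<rho>' z = {y. ?E z y \<or> z \<in> m \<and> y \<in> m}"
    by (simp add: circle_of_def)
  show ?thesis
  proof (cases "z \<in> m")
    case True
    then have "{y. ?E z y \<or> z \<in> m \<and> y \<in> m} = m" using m_E by blast
    then show ?thesis using True eq by simp
  next
    case False
    then show ?thesis unfolding eq by (simp add: circle_of_def)
  qed
qed

text \<open>The merge expressed through the set differences from which \<open>edge_map\<close> is
  computed.\<close>

lemma circles_merge:
  assumes "p < length w" and "\<not> vertical_smoothing w \<rho> p" and "vertical_smoothing w \<rho>' p"
    and "\<And>q. q < length w \<Longrightarrow> q \<noteq> p \<Longrightarrow> vertical_smoothing w \<rho>' q = vertical_smoothing w \<rho> q"
    and "circle_of b w \<rho> (p, left_strand w p) \<noteq> circle_of b w \<rho> (p + 1, left_strand w p)"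
  defines "u \<equiv> circle_of b w \<rho> (p, left_strand w p)"
    and "v \<equiv> circle_of b w \<rho> (p + 1, left_strand w p)"
  shows "circles b w \<rho>' - circles b w \<rho> = {u \<union> v}"
    and "circles b w \<rho> - circles b w \<rho>' = {u, v}"
    and "u \<noteq> v" and "u \<in> circles b w \<rho>" and "v \<in> circles b w \<rho>"
proof -
  let ?top = "(p, left_strand w p)" and ?bot = "(p + 1, left_strand w p)"
  have merge: "circle_of b w \<rho>' z = (if z \<in> u \<union> v then u \<union> v else circle_of b w \<rho> z)" for z
    unfolding u_def v_def by (rule circle_of_merge) fact+
  have pts: "?top \<in> points b w" "?bot \<in> points b w"
    using assms(1) left_strand_pos[of p] left_strand_less[of p] by (auto simp: points_def)
  show "u \<noteq> v" using assms by simp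
  show "u \<in> circles b w \<rho>" "v \<in> circles b w \<rho>" using pts by (auto simp: circles_eq u_def v_def)
  have self: "z \<in> circle_of b w \<rho> z" for z by (simp add: mem_circle_of_iff)
  have mem: "circle_of b w \<rho> z = u \<longleftrightarrow> z \<in> u" "circle_of b w \<rho> z = v \<longleftrightarrow> z \<in> v" for z
    unfolding u_def v_def mem_circle_of_iff circle_of_eq_iff by (metis equivclp_sym)+
  have uv: "?top \<in> u" "?bot \<in> v" using self by (auto simp: u_def v_def)
  have disj: "u \<inter> v = {}" using mem \<open>u \<noteq> v\<close> by blast
  have new: "u \<union> v \<notin> circles b w \<rho>"
  proof
    assume "u \<union> v \<in> circles b w \<rho>"
    then obtain z where "u \<union> v = circle_of b w \<rho> z" by (auto simp: circles_eq)
    then have "z \<in> u \<union> v" using self by blast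
    then have "circle_of b w \<rho> z = u \<or> circle_of b w \<rho> z = v" using mem by blast
    then show False using \<open>u \<union> v = circle_of b w \<rho> z\<close> uv disj by blast
  qed
  have circ': "circles b w \<rho>' = insert (u \<union> v) (circles b w \<rho> - {u, v})"
  proof -
    have "circle_of b w \<rho>' z \<in> insert (u \<union> v) (circles b w \<rho> - {u, v})" if "z \<in> points b w" for z
      using that mem[of z] by (auto simp: merge circles_eq)
    moreover have "u \<union> v \<in> circles b w \<rho>'" using merge[of ?top] uv pts by (auto simp: circles_eq)
    moreover have "c \<in> circles b w \<rho>'" if "c \<in> circles b w \<rho> - {u, v}" for c
    proof -
      obtain z where z: "z \<in> points b w" "c = circle_of b w \<rho> z" using \<open>c \<in> _\<close> by (auto simp: circles_eq)
      then have "z \<notin> u \<union> v" using that mem[of z] by auto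
      then have "circle_of b w \<rho>' z = c" using merge z by auto
      then show ?thesis using z by (auto simp: circles_eq)
    qed
    ultimately show ?thesis by (auto simp: circles_eq[of b w \<rho>'])
  qed
  show "circles b w \<rho>' - circles b w \<rho> = {u \<union> v}" using circ' new by auto
  show "circles b w \<rho> - circles b w \<rho>' = {u, v}"
    using circ' new \<open>u \<in> circles b w \<rho>\<close> \<open>v \<in> circles b w \<rho>\<close> by auto
qed

end

section \<open>Khovanov homology as a group of cosets\<close>

text \<open>
  The cosets of \<open>H\<close> represented by elements of \<open>G\<close> form a group even if \<open>H\<close> is not contained in \<open>G\<close>.
  This is why it is never necessary to know that the Khovanov differential squares to zero or
  that it preserves the quantum degree.
\<close>

locale frag_quotient =
  fixes G :: "('a \<Rightarrow>\<^sub>0 int) monoid" and H :: "('a \<Rightarrow>\<^sub>0 int) set"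
  assumes mult_eq: "monoid.mult G = (+)"
    and zero_mem: "0 \<in> carrier G"
    and add_mem: "x \<in> carrier G \<Longrightarrow> y \<in> carrier G \<Longrightarrow> x + y \<in> carrier G"
    and uminus_mem: "x \<in> carrier G \<Longrightarrow> - x \<in> carrier G"
    and H_zero: "0 \<in> H"
    and H_add: "x \<in> H \<Longrightarrow> y \<in> H \<Longrightarrow> x + y \<in> H"
    and H_uminus: "x \<in> H \<Longrightarrow> - x \<in> H"
begin

abbreviation coset :: "('a \<Rightarrow>\<^sub>0 int) \<Rightarrow> ('a \<Rightarrow>\<^sub>0 int) set" where
  "coset a \<equiv> H #>\<^bsub>G\<^esub> a"

lemma mem_coset: "x \<in> coset a \<longleftrightarrow> x - a \<in> H"
proof
  assume "x - a \<in> H"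
  moreover have "x = (x - a) + a" by simp
  ultimately show "x \<in> coset a" unfolding r_coset_def mult_eq by blast
qed (auto simp: r_coset_def mult_eq)

lemma coset_zero: "coset 0 = H"
  by (auto simp: mem_coset)

lemma coset_eq_H: "coset a = H \<longleftrightarrow> a \<in> H"
proof
  assume "coset a = H"
  moreover have "a \<in> coset a" by (simp add: mem_coset H_zero)
  ultimately show "a \<in> H" by simp
next
  assume a: "a \<in> H"
  show "coset a = H"
  proof (intro equalityI subsetI)
    fix x assume "x \<in> coset a"
    then show "x \<in> H" using H_add[OF _ a, of "x - a"] by (simp add: mem_coset)
  next
    fix x assume "x \<in> H"
    then show "x \<in> coset a" using H_add[OF _ H_uminus[OF a], of x] by (simp add: mem_coset)
  qed
qed

lemma coset_mult: "coset a \<otimes>\<^bsub>G Mod H\<^esub> coset b = coset (a + b)"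
proof (intro equalityI subsetI)
  fix x assume "x \<in> coset a \<otimes>\<^bsub>G Mod H\<^esub> coset b"
  then obtain y z where "y \<in> coset a" "z \<in> coset b" "x = y + z"
    by (auto simp: set_mult_def mult_eq)
  then show "x \<in> coset (a + b)"
    using H_add[of "y - a" "z - b"] by (simp add: mem_coset algebra_simps)
next
  fix x assume "x \<in> coset (a + b)"
  then have "x - b \<in> coset a" "b \<in> coset b" by (simp_all add: mem_coset H_zero algebra_simps)
  moreover have "x = (x - b) + b" by simp
  ultimately show "x \<in> coset a \<otimes>\<^bsub>G Mod H\<^esub> coset b"
    unfolding mult_FactGroup set_mult_def mult_eq by blast
qed

lemma comm_group_quotient: "comm_group (G Mod H)"
proof (rule comm_groupI)
  show "\<one>\<^bsub>G Mod H\<^esub> \<in> carrier (G Mod H)"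
    using zero_mem coset_zero unfolding carrier_FactGroup one_FactGroup by blast
next
  fix x assume "x \<in> carrier (G Mod H)"
  then obtain a where a: "a \<in> carrier G" "x = coset a" by (auto simp: carrier_FactGroup)
  have "coset (- a) \<otimes>\<^bsub>G Mod H\<^esub> x = \<one>\<^bsub>G Mod H\<^esub>"
    unfolding a(2) coset_mult by (simp add: coset_zero)
  then show "\<exists>y\<in>carrier (G Mod H). y \<otimes>\<^bsub>G Mod H\<^esub> x = \<one>\<^bsub>G Mod H\<^esub>"
    using uminus_mem[OF a(1)] unfolding carrier_FactGroup by blast
  have "coset 0 \<otimes>\<^bsub>G Mod H\<^esub> x = x"
    unfolding a(2) coset_mult by simp
  then show "\<one>\<^bsub>G Mod H\<^esub> \<otimes>\<^bsub>G Mod H\<^esub> x = x"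
    by (simp add: coset_zero)
next
  fix x y assume "x \<in> carrier (G Mod H)" "y \<in> carrier (G Mod H)"
  then obtain a b where ab: "a \<in> carrier G" "x = coset a" "b \<in> carrier G" "y = coset b"
    by (auto simp: carrier_FactGroup)
  show "x \<otimes>\<^bsub>G Mod H\<^esub> y \<in> carrier (G Mod H)"
    using ab add_mem unfolding ab(2,4) coset_mult carrier_FactGroup by blast
  show "x \<otimes>\<^bsub>G Mod H\<^esub> y = y \<otimes>\<^bsub>G Mod H\<^esub> x"
    unfolding ab(2,4) coset_mult by (simp add: add.commute)
next
  fix x y z assume "x \<in> carrier (G Mod H)" "y \<in> carrier (G Mod H)" "z \<in> carrier (G Mod H)"
  then obtain a b c where abc: "x = coset a" "y = coset b" "z = coset c"
    by (auto simp: carrier_FactGroup)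
  show "x \<otimes>\<^bsub>G Mod H\<^esub> y \<otimes>\<^bsub>G Mod H\<^esub> z = x \<otimes>\<^bsub>G Mod H\<^esub> (y \<otimes>\<^bsub>G Mod H\<^esub> z)"
    unfolding abc coset_mult by (simp add: add.assoc)
qed

sublocale quotient: comm_group "G Mod H" by (rule comm_group_quotient)

lemma coset_carrier: "a \<in> carrier G \<Longrightarrow> coset a \<in> carrier (G Mod H)"
  by (auto simp: carrier_FactGroup)

lemma coset_nat_pow: "coset a [^]\<^bsub>G Mod H\<^esub> (n :: nat) = coset (frag_cmul (int n) a)"
proof (induction n)
  case (Suc n)
  then show ?case
    unfolding quotient.nat_pow_Suc by (simp only: coset_mult) (simp add: frag_cmul_distrib add.commute)
qed (simp add: coset_zero)

lemma frag_cmul_nat_mem: "a \<in> carrier G \<Longrightarrow> frag_cmul (int n) a \<in> carrier G"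
  by (induction n) (simp_all add: zero_mem add_mem frag_cmul_distrib)

lemma frag_cmul_mem: "a \<in> carrier G \<Longrightarrow> frag_cmul c a \<in> carrier G"
  using frag_cmul_nat_mem[of a "nat c"] uminus_mem[OF frag_cmul_nat_mem[of a "nat (- c)"]]
  by (cases "c \<ge> 0") auto

lemma coset_int_pow:
  assumes "a \<in> carrier G"
  shows "coset a [^]\<^bsub>G Mod H\<^esub> (c :: int) = coset (frag_cmul c a)"
proof (cases "c \<ge> 0")
  case True
  then obtain n where "c = int n" using nonneg_int_cases by blast
  then show ?thesis using coset_nat_pow by (simp add: int_pow_int)
next
  case False
  then obtain n where n: "c = - int n" by (metis int_cases2 of_nat_0_le_iff)
  have "coset a [^]\<^bsub>G Mod H\<^esub> c = inv\<^bsub>G Mod H\<^esub> (coset a [^]\<^bsub>G Mod H\<^esub> n)"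
    unfolding n by (rule quotient.int_pow_neg_int[OF coset_carrier[OF assms]])
  also have "\<dots> = coset (frag_cmul c a)"
  proof (rule quotient.inv_equality)
    show "coset (frag_cmul c a) \<otimes>\<^bsub>G Mod H\<^esub> (coset a [^]\<^bsub>G Mod H\<^esub> n) = \<one>\<^bsub>G Mod H\<^esub>"
      unfolding coset_nat_pow coset_mult by (simp add: n frag_cmul_distrib[symmetric] coset_zero)
  qed (auto simp only: coset_nat_pow intro!: coset_carrier frag_cmul_mem assms)
  finally show ?thesis .
qed

lemma finprod_coset:
  assumes "finite S" and "\<And>s. s \<in> S \<Longrightarrow> r s \<in> carrier G"
  shows "finprod (G Mod H) (\<lambda>s. coset (r s) [^]\<^bsub>G Mod H\<^esub> (c s :: int)) S
    = coset (\<Sum>s\<in>S. frag_cmul (c s) (r s))"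
  using assms
proof (induction S)
  case empty
  then show ?case by (simp add: coset_zero)
next
  case (insert x S)
  have "finprod (G Mod H) (\<lambda>s. coset (r s) [^]\<^bsub>G Mod H\<^esub> c s) (insert x S)
     = coset (r x) [^]\<^bsub>G Mod H\<^esub> c x \<otimes>\<^bsub>G Mod H\<^esub> finprod (G Mod H) (\<lambda>s. coset (r s) [^]\<^bsub>G Mod H\<^esub> c s) S"
    using insert by (intro quotient.finprod_insert) (auto intro!: quotient.int_pow_closed coset_carrier)
  also have "\<dots> = coset (\<Sum>s\<in>insert x S. frag_cmul (c s) (r s))"
    using insert coset_mult by (simp add: coset_int_pow)
  finally show ?case .
qed

end

section \<open>Direct sums of commutative groups\<close>

lemma comm_group_sum_group:
  assumes "\<And>i. i \<in> I \<Longrightarrow> comm_group (G i)"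
  shows "comm_group (sum_group I G)"
proof -
  have grp: "group (G i)" if "i \<in> I" for i using assms[OF that] by (simp add: comm_group.axioms(2))
  show ?thesis
  proof (rule group.group_comm_groupI)
    show "group (sum_group I G)" using grp by (rule sum_group)
    fix x y assume xy: "x \<in> carrier (sum_group I G)" "y \<in> carrier (sum_group I G)"
    have "x i \<otimes>\<^bsub>G i\<^esub> y i = y i \<otimes>\<^bsub>G i\<^esub> x i" if "i \<in> I" for i
      using comm_groupE(4)[OF assms[OF that]] xy that by (auto simp: carrier_sum_group grp PiE_iff)
    then show "x \<otimes>\<^bsub>sum_group I G\<^esub> y = y \<otimes>\<^bsub>sum_group I G\<^esub> x" by (auto simp: restrict_def)
  qed
qed

text \<open>The projection to a summand is a homomorphism, hence commutes with finite products of
  integer powers. Relations in \<open>Kh_total\<close> can therefore be checked in one quantum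
  degree at a time.\<close>

lemma finprod_sum_group:
  assumes "\<And>i. i \<in> I \<Longrightarrow> comm_group (G i)" and "i \<in> I"
    and "finite S" and "\<And>s. s \<in> S \<Longrightarrow> f s \<in> carrier (sum_group I G)"
  shows "finprod (sum_group I G) (\<lambda>s. f s [^]\<^bsub>sum_group I G\<^esub> (c s :: int)) S i
    = finprod (G i) (\<lambda>s. f s i [^]\<^bsub>G i\<^esub> c s) S"
proof -
  let ?P = "sum_group I G"
  interpret P: comm_group ?P using assms(1) by (rule comm_group_sum_group)
  interpret Gi: comm_group "G i" using assms(1,2) by blast
  have grp: "group (G i)" if "i \<in> I" for i using assms(1)[OF that] by (simp add: comm_group.axioms(2))
  have mem: "x i \<in> carrier (G i)" if "x \<in> carrier ?P" for x
    using that assms(2) by (auto simp: carrier_sum_group grp PiE_iff)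
  have "(\<lambda>x. x i) \<in> hom ?P (G i)"
    using mem assms(2) by (auto simp: hom_def)
  then have pow: "(x [^]\<^bsub>?P\<^esub> (n :: int)) i = x i [^]\<^bsub>G i\<^esub> n" if "x \<in> carrier ?P" for x n
    using hom_int_pow[OF _ that P.is_group Gi.is_group] by blast
  show ?thesis
    using assms(3,4)
  proof (induction S)
    case empty
    then show ?case using assms(2) by simp
  next
    case (insert x S)
    have "finprod ?P (\<lambda>s. f s [^]\<^bsub>?P\<^esub> c s) (insert x S)
      = f x [^]\<^bsub>?P\<^esub> c x \<otimes>\<^bsub>?P\<^esub> finprod ?P (\<lambda>s. f s [^]\<^bsub>?P\<^esub> c s) S"
      using insert by (intro P.finprod_insert) auto
    moreover have "finprod (G i) (\<lambda>s. f s i [^]\<^bsub>G i\<^esub> c s) (insert x S)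
      = f x i [^]\<^bsub>G i\<^esub> c x \<otimes>\<^bsub>G i\<^esub> finprod (G i) (\<lambda>s. f s i [^]\<^bsub>G i\<^esub> c s) S"
      using insert mem by (intro Gi.finprod_insert) auto
    ultimately show ?case using insert pow assms(2) by simp
  qed
qed

section \<open>Cycles, boundaries and homology classes\<close>

lemma chain_group_mult: "monoid.mult (chain_group b w i j) = (+)"
  by (simp add: chain_group_def fun_eq_iff)

lemma kernel_differential:
  "kernel (chain_group b w i j) (chain_group b w i' j) (differential b w)
    = {x. Poly_Mapping.keys x \<subseteq> {x \<in> states b w. homological_degree w x = i \<and> quantum_degree b w x = j}
        \<and> differential b w x = 0}"
  by (auto simp: kernel_def chain_group_def)

text \<open>The kernel is already closed under the group operations because
  \<open>differential\<close> is additive, so passing to the generated subgroup adds no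
  elements.\<close>

lemma carrier_cycle_group:
  "carrier (cycle_group b w i j)
    = {x. Poly_Mapping.keys x \<subseteq> {x \<in> states b w. homological_degree w x = i \<and> quantum_degree b w x = j}
        \<and> differential b w x = 0}"
proof -
  let ?K = "kernel (chain_group b w i j) (chain_group b w (i + 1) j) (differential b w)"
  interpret C: group "chain_group b w i j" by (simp add: chain_group_def)
  have "subgroup ?K (chain_group b w i j)"
  proof (rule C.subgroupI)
    show "?K \<subseteq> carrier (chain_group b w i j)" by (auto simp: kernel_def)
    have "0 \<in> ?K" unfolding kernel_differential by (simp add: differential_def)
    then show "?K \<noteq> {}" by blast
    show "inv\<^bsub>chain_group b w i j\<^esub> x \<in> ?K" if "x \<in> ?K" for x
      using that unfolding kernel_differential
      by (simp add: chain_group_def differential_def frag_extend_minus)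
    show "x \<otimes>\<^bsub>chain_group b w i j\<^esub> y \<in> ?K" if "x \<in> ?K" "y \<in> ?K" for x y
      using that keys_add[of x y] unfolding kernel_differential chain_group_mult
      by (auto simp: differential_def frag_extend_add)
  qed
  then have "carrier (cycle_group b w i j) = ?K"
    unfolding cycle_group_def by (rule subgroup.carrier_subgroup_generated_subgroup)
  then show ?thesis by (simp only: kernel_differential)
qed

interpretation Kh: frag_quotient "cycle_group b w i j" "boundaries b w i j" for b w i j
proof
  show "monoid.mult (cycle_group b w i j) = (+)"
    by (simp add: cycle_group_def chain_group_mult)
  show "0 \<in> carrier (cycle_group b w i j)"
    by (simp add: carrier_cycle_group differential_def)
  show "x + y \<in> carrier (cycle_group b w i j)"
    if "x \<in> carrier (cycle_group b w i j)" "y \<in> carrier (cycle_group b w i j)" for x y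
    using that keys_add[of x y] unfolding carrier_cycle_group by (auto simp: differential_def frag_extend_add)
  show "- x \<in> carrier (cycle_group b w i j)" if "x \<in> carrier (cycle_group b w i j)" for x
    using that unfolding carrier_cycle_group by (simp add: differential_def frag_extend_minus)
  show "0 \<in> boundaries b w i j"
    unfolding boundaries_def differential_def
    by (rule image_eqI[where x = 0]) (simp_all add: chain_group_def)
  show "x + y \<in> boundaries b w i j" if "x \<in> boundaries b w i j" "y \<in> boundaries b w i j" for x y
  proof -
    note xy = that
    obtain x' y' where *: "x' \<in> carrier (chain_group b w (i - 1) j)" "x = differential b w x'"
      "y' \<in> carrier (chain_group b w (i - 1) j)" "y = differential b w y'"
      using xy by (auto simp: boundaries_def)
    then have "x + y = differential b w (x' + y')" by (simp add: differential_def frag_extend_add)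
    moreover have "x' + y' \<in> carrier (chain_group b w (i - 1) j)"
      using *(1,3) keys_add[of x' y'] by (auto simp: chain_group_def)
    ultimately show ?thesis by (auto simp: boundaries_def)
  qed
  show "- x \<in> boundaries b w i j" if "x \<in> boundaries b w i j" for x
  proof -
    note x = that
    obtain x' where *: "x' \<in> carrier (chain_group b w (i - 1) j)" "x = differential b w x'"
      using x by (auto simp: boundaries_def)
    then have "- x = differential b w (- x')" by (simp add: differential_def frag_extend_minus)
    moreover have "- x' \<in> carrier (chain_group b w (i - 1) j)"
      using *(1) by (simp add: chain_group_def)
    ultimately show ?thesis by (auto simp: boundaries_def)
  qed
qed

lemma comm_group_Kh: "comm_group (Kh b w i j)"
  unfolding Kh_def by (rule Kh.comm_group_quotient)

lemma carrier_Kh_total: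
  "carrier (Kh_total b w i) = {x. (\<forall>j. x j \<in> carrier (Kh b w i j)) \<and> finite {j. x j \<noteq> \<one>\<^bsub>Kh b w i j\<^esub>}}"
  unfolding Kh_total_def using comm_group_Kh
  by (subst carrier_sum_group) (auto simp: PiE_iff comm_group.axioms(2))

text \<open>The bridge from \<open>Z_independent\<close> to chains: a relation between homology
  classes is tested on representatives \<open>r\<close>.\<close>

lemma finprod_Kh_total_eq_one:
  assumes "finite S" and "S \<subseteq> carrier (Kh_total b w i)"
    and "\<And>s j. s \<in> S \<Longrightarrow> r s j \<in> carrier (cycle_group b w i j)"
    and "\<And>s j. s \<in> S \<Longrightarrow> s j = boundaries b w i j #>\<^bsub>cycle_group b w i j\<^esub> r s j"
  shows "finprod (Kh_total b w i) (\<lambda>s. s [^]\<^bsub>Kh_total b w i\<^esub> (c s :: int)) S = \<one>\<^bsub>Kh_total b w i\<^esub>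
    \<longleftrightarrow> (\<forall>j. (\<Sum>s\<in>S. frag_cmul (c s) (r s j)) \<in> boundaries b w i j)"
proof -
  have "finprod (Kh_total b w i) (\<lambda>s. s [^]\<^bsub>Kh_total b w i\<^esub> c s) S j
     = boundaries b w i j #>\<^bsub>cycle_group b w i j\<^esub> (\<Sum>s\<in>S. frag_cmul (c s) (r s j))" for j
  proof -
    have "finprod (Kh_total b w i) (\<lambda>s. s [^]\<^bsub>Kh_total b w i\<^esub> c s) S j
      = finprod (Kh b w i j) (\<lambda>s. s j [^]\<^bsub>Kh b w i j\<^esub> c s) S"
      using assms(1,2) comm_group_Kh unfolding Kh_total_def by (intro finprod_sum_group) auto
    also have "\<dots> = finprod (Kh b w i j)
        (\<lambda>s. (boundaries b w i j #>\<^bsub>cycle_group b w i j\<^esub> r s j) [^]\<^bsub>Kh b w i j\<^esub> c s) S"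
    proof (rule comm_monoid.finprod_cong')
      interpret K: comm_group "Kh b w i j" by (rule comm_group_Kh)
      show "comm_monoid (Kh b w i j)" by (rule K.comm_monoid_axioms)
      have "boundaries b w i j #>\<^bsub>cycle_group b w i j\<^esub> r s j \<in> carrier (Kh b w i j)" if "s \<in> S" for s
        unfolding Kh_def using Kh.coset_carrier assms(3) that by blast
      then show "(\<lambda>s. (boundaries b w i j #>\<^bsub>cycle_group b w i j\<^esub> r s j) [^]\<^bsub>Kh b w i j\<^esub> c s)
          \<in> S \<rightarrow> carrier (Kh b w i j)" by auto
    qed (simp_all add: assms(4))
    also have "\<dots> = boundaries b w i j #>\<^bsub>cycle_group b w i j\<^esub> (\<Sum>s\<in>S. frag_cmul (c s) (r s j))"
      unfolding Kh_def using assms(1,3) by (rule Kh.finprod_coset)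
    finally show ?thesis .
  qed
  then show ?thesis
    by (simp add: fun_eq_iff Kh_total_def Kh_def Kh.coset_eq_H)
qed

section \<open>Linear dependence over the integers and bounds for the rank\<close>

lemma integer_relation:
  fixes v :: "'s \<Rightarrow> 'x \<Rightarrow> int"
  assumes "finite Y" "finite S" "card Y < card S"
  shows "\<exists>c. (\<exists>s\<in>S. c s \<noteq> 0) \<and> (\<forall>y\<in>Y. (\<Sum>s\<in>S. c s * v s y) = 0)"
  using assms
proof (induction Y arbitrary: S v)
  case empty
  then have "S \<noteq> {}" by auto
  then show ?case by (intro exI[of _ "\<lambda>_. 1"]) auto
next
  case (insert y Y)
  show ?case
  proof (cases "\<forall>s\<in>S. v s y = 0")
    case True
    have "card Y < card S" using insert by simp
    then obtain c where "\<exists>s\<in>S. c s \<noteq> 0" "\<forall>y\<in>Y. (\<Sum>s\<in>S. c s * v s y) = 0"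
      using insert.IH[OF insert.prems(1)] by blast
    then show ?thesis using True by (intro exI[of _ c]) auto
  next
    case False
    then obtain s0 where s0: "s0 \<in> S" "v s0 y \<noteq> 0" by blast
    let ?S = "S - {s0}"
    have "card Y < card ?S" "finite ?S" using insert s0 by auto
    \<comment> \<open>Gaussian elimination without fractions: each remaining vector is scaled by the
      pivot entry \<open>v s0 y\<close> and corrected by a multiple of the vector of
      \<open>s0\<close>, which clears its coordinate \<open>y\<close>.\<close>
    from insert.IH[OF this(2,1), of "\<lambda>s x. v s0 y * v s x - v s y * v s0 x"]
    obtain c where c: "\<exists>s\<in>?S. c s \<noteq> 0"
      "\<And>x. x \<in> Y \<Longrightarrow> (\<Sum>s\<in>?S. c s * (v s0 y * v s x - v s y * v s0 x)) = 0"
      by blast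
    \<comment> \<open>The relation for the eliminated vectors, rewritten for the original ones. The
      factor \<open>v s0 y\<close> is nonzero, so a nonzero coefficient stays nonzero.\<close>
    define d where "d = (\<lambda>s. if s = s0 then - (\<Sum>s\<in>?S. c s * v s y) else c s * v s0 y)"
    have sum_d: "(\<Sum>s\<in>S. d s * v s x) = (\<Sum>s\<in>?S. c s * (v s0 y * v s x - v s y * v s0 x))" for x
    proof -
      have "(\<Sum>s\<in>S. d s * v s x) = d s0 * v s0 x + (\<Sum>s\<in>?S. d s * v s x)"
        using s0 insert.prems by (intro sum.remove) auto
      also have "(\<Sum>s\<in>?S. d s * v s x) = (\<Sum>s\<in>?S. c s * v s0 y * v s x)"
        by (intro sum.cong) (auto simp: d_def)
      also have "d s0 * v s0 x = - (\<Sum>s\<in>?S. c s * v s y * v s0 x)"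
        by (simp add: d_def sum_distrib_right)
      finally show ?thesis by (simp add: sum_subtractf[symmetric] algebra_simps)
    qed
    have "(\<Sum>s\<in>S. d s * v s x) = 0" if "x \<in> insert y Y" for x
    proof (cases "x = y")
      case True
      then show ?thesis unfolding sum_d by (intro sum.neutral) (simp add: mult.commute)
    next
      case False
      then show ?thesis using that c(2) unfolding sum_d by blast
    qed
    moreover have "\<exists>s\<in>S. d s \<noteq> 0" using c(1) s0 by (auto simp: d_def)
    ultimately show ?thesis by blast
  qed
qed

lemma finite_states: "finite (states b w)"
proof -
  have "finite (Sigma (Pow {..<length w}) (\<lambda>\<rho>. Pow (circles b w \<rho>)))"
    by (auto simp: finite_circles)
  moreover have "states b w = Sigma (Pow {..<length w}) (\<lambda>\<rho>. Pow (circles b w \<rho>))"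
    by (auto simp: states_def)
  ultimately show ?thesis by simp
qed

text \<open>Every state has a single quantum degree, so a family of representatives, one for each
  degree, has at most one relevant coordinate per state; more classes than states satisfy a relation
  already between these representatives. The bound makes the supremum in \<open>abelian_rank\<close>
  meaningful.\<close>

lemma card_Z_independent_le:
  assumes "finite S" and S: "S \<subseteq> carrier (Kh_total b w i)" and indep: "Z_independent (Kh_total b w i) S"
  shows "card S \<le> card (states b w)"
proof (rule ccontr)
  assume "\<not> card S \<le> card (states b w)"
  then have less: "card (states b w) < card S" by simp
  have "\<exists>a. a \<in> carrier (cycle_group b w i j) \<and> s j = boundaries b w i j #>\<^bsub>cycle_group b w i j\<^esub> a"
    if "s \<in> S" for s j
    using S that unfolding carrier_Kh_total Kh_def carrier_FactGroup by blast
  then obtain r where r: "\<And>s j. s \<in> S \<Longrightarrow> r s j \<in> carrier (cycle_group b w i j)"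
    "\<And>s j. s \<in> S \<Longrightarrow> s j = boundaries b w i j #>\<^bsub>cycle_group b w i j\<^esub> r s j"
    by metis
  obtain c where c: "\<exists>s\<in>S. c s \<noteq> 0"
    "\<And>x. x \<in> states b w \<Longrightarrow> (\<Sum>s\<in>S. c s * Poly_Mapping.lookup (r s (quantum_degree b w x)) x) = 0"
    using integer_relation[OF finite_states \<open>finite S\<close> less,
        of "\<lambda>s x. Poly_Mapping.lookup (r s (quantum_degree b w x)) x"] by blast
  have "(\<Sum>s\<in>S. frag_cmul (c s) (r s j)) = 0" for j
  proof (rule poly_mapping_eqI)
    fix x
    have eq: "Poly_Mapping.lookup (\<Sum>s\<in>S. frag_cmul (c s) (r s j)) x
        = (\<Sum>s\<in>S. c s * Poly_Mapping.lookup (r s j) x)"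
      by (simp add: lookup_sum)
    show "Poly_Mapping.lookup (\<Sum>s\<in>S. frag_cmul (c s) (r s j)) x = Poly_Mapping.lookup 0 x"
    proof (cases "x \<in> states b w \<and> quantum_degree b w x = j")
      case True
      then show ?thesis unfolding eq using c(2)[of x] by simp
    next
      case False
      then have "Poly_Mapping.lookup (r s j) x = 0" if "s \<in> S" for s
        using r(1)[OF that, of j] unfolding carrier_cycle_group by (auto simp: in_keys_iff)
      then show ?thesis unfolding eq by simp
    qed
  qed
  then have "finprod (Kh_total b w i) (\<lambda>s. s [^]\<^bsub>Kh_total b w i\<^esub> c s) S = \<one>\<^bsub>Kh_total b w i\<^esub>"
    using finprod_Kh_total_eq_one[where r = r and S = S and c = c, OF \<open>finite S\<close> S r] by (simp add: Kh.H_zero)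
  then show False using indep c(1) unfolding Z_independent_def by blast
qed

lemma card_le_abelian_rank_Kh_total:
  assumes "finite S" and "S \<subseteq> carrier (Kh_total b w i)" and "Z_independent (Kh_total b w i) S"
  shows "card S \<le> abelian_rank (Kh_total b w i)"
  unfolding abelian_rank_def
proof (rule cSup_upper)
  show "bdd_above {card S |S. finite S \<and> S \<subseteq> carrier (Kh_total b w i) \<and> Z_independent (Kh_total b w i) S}"
    using card_Z_independent_le by (auto intro!: bdd_aboveI[where M = "card (states b w)"])
qed (use assms in blast)

text \<open>The coefficients at the states \<open>x s\<close> vanish on boundaries, so they are
  functionals on homology; being dual to the cycles \<open>z s\<close>, they force every coefficient
  of a relation between the classes to be 0.\<close>

lemma abelian_rank_Kh_total_ge:
  fixes z :: "'s \<Rightarrow> state \<Rightarrow>\<^sub>0 int" and x :: "'s \<Rightarrow> state"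
  assumes "finite F"
    and cycle: "\<And>s. s \<in> F \<Longrightarrow> z s \<in> carrier (cycle_group b w i j)"
    and dual: "\<And>s s'. s \<in> F \<Longrightarrow> s' \<in> F \<Longrightarrow> Poly_Mapping.lookup (z s') (x s) = (if s' = s then 1 else 0)"
    and bd: "\<And>s y. s \<in> F \<Longrightarrow> y \<in> boundaries b w i j \<Longrightarrow> Poly_Mapping.lookup y (x s) = 0"
  shows "card F \<le> abelian_rank (Kh_total b w i)"
proof -
  \<comment> \<open>The class of \<open>z s\<close> is placed in the summand of degree
    \<open>j\<close>, with 0 in all other quantum degrees.\<close>
  define r where "r = (\<lambda>s j'. if j' = j then z s else 0)"
  define e where "e = (\<lambda>s j'. boundaries b w i j' #>\<^bsub>cycle_group b w i j'\<^esub> r s j')"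
  have r_cycle: "r s j' \<in> carrier (cycle_group b w i j')" if "s \<in> F" for s j'
    using cycle[OF that] Kh.zero_mem by (simp add: r_def)
  have e_mem: "e s \<in> carrier (Kh_total b w i)" if "s \<in> F" for s
  proof -
    have "e s j' = \<one>\<^bsub>Kh b w i j'\<^esub>" if "j' \<noteq> j" for j'
      using that by (simp add: e_def r_def Kh_def Kh.coset_zero)
    then have "{j'. e s j' \<noteq> \<one>\<^bsub>Kh b w i j'\<^esub>} \<subseteq> {j}" by blast
    moreover have "e s j' \<in> carrier (Kh b w i j')" for j'
      unfolding e_def Kh_def using Kh.coset_carrier[OF r_cycle[OF that]] .
    ultimately show ?thesis unfolding carrier_Kh_total using finite_subset by blast
  qed
  have inj: "inj_on e F"
  proof (rule inj_onI, rule ccontr)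
    fix s s' assume s: "s \<in> F" "s' \<in> F" "e s = e s'" "s \<noteq> s'"
    have "z s \<in> e s j" by (simp add: e_def r_def Kh.mem_coset Kh.H_zero)
    then have "z s - z s' \<in> boundaries b w i j" unfolding s(3) by (simp add: e_def r_def Kh.mem_coset)
    then have "Poly_Mapping.lookup (z s - z s') (x s) = 0" using bd s(1) by blast
    then show False using dual s by (simp add: lookup_minus)
  qed
  have "Z_independent (Kh_total b w i) (e ` F)"
    unfolding Z_independent_def
  proof (intro allI impI ballI)
    fix c :: "(int \<Rightarrow> (state \<Rightarrow>\<^sub>0 int) set) \<Rightarrow> int" and g
    assume c: "finprod (Kh_total b w i) (\<lambda>s. s [^]\<^bsub>Kh_total b w i\<^esub> c s) (e ` F) = \<one>\<^bsub>Kh_total b w i\<^esub>"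
      and "g \<in> e ` F"
    then obtain s where s: "s \<in> F" "g = e s" by blast
    define r' where "r' = (\<lambda>g. r (the_inv_into F e g))"
    have r': "r' (e s) = r s" if "s \<in> F" for s
      using the_inv_into_f_f[OF inj that] by (simp add: r'_def)
    have "(\<Sum>g\<in>e ` F. frag_cmul (c g) (r' g j)) \<in> boundaries b w i j"
      using c \<open>finite F\<close> e_mem r_cycle r'
      by (subst (asm) finprod_Kh_total_eq_one[where r = r']) (auto simp: e_def[abs_def])
    then have "Poly_Mapping.lookup (\<Sum>g\<in>e ` F. frag_cmul (c g) (r' g j)) (x s) = 0" by (rule bd[OF s(1)])
    moreover have "Poly_Mapping.lookup (\<Sum>g\<in>e ` F. frag_cmul (c g) (r' g j)) (x s)
        = (\<Sum>s'\<in>F. c (e s') * Poly_Mapping.lookup (z s') (x s))"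
      unfolding lookup_sum sum.reindex[OF inj] o_def
      by (intro sum.cong refl) (simp add: r' r_def)
    moreover have "\<dots> = (\<Sum>s'\<in>F. if s' = s then c (e s') else 0)"
      using dual[OF s(1)] by (intro sum.cong refl) simp
    ultimately show "c g = 0" using s \<open>finite F\<close> by simp
  qed
  then have "card (e ` F) \<le> abelian_rank (Kh_total b w i)"
    using \<open>finite F\<close> e_mem by (intro card_le_abelian_rank_Kh_total) auto
  then show ?thesis using inj by (simp add: card_image)
qed

section \<open>The resolutions of the braid words\<close>

lemma length_L_word: "length (L_word t) = 6 * t + 2"
  by (simp add: L_word_def length_concat sum_list_replicate)

lemma L_word_Suc: "L_word (Suc t) = [1, 3, 2, 2, 2, 2] @ L_word t"
  by (simp add: L_word_def)

lemma nth_L_word: "p < 6 * t + 2 \<Longrightarrow> L_word t ! p = [1, 3, 2, 2, 2, 2] ! (p mod 6)"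
proof (induction t arbitrary: p)
  case 0
  then have "p = 0 \<or> p = 1" by auto
  then show ?case by (auto simp: L_word_def)
next
  case (Suc t)
  show ?case
  proof (cases "p < 6")
    case True
    then show ?thesis by (simp add: L_word_Suc nth_append del: append.simps)
  next
    case False
    then have "p mod 6 = (p - 6) mod 6" by (simp add: le_mod_geq)
    moreover have "L_word (Suc t) ! p = L_word t ! (p - 6)"
    proof -
      have "length [1, 3, 2, 2, 2, 2 :: int] = 6" by simp
      then show ?thesis using False by (simp only: L_word_Suc nth_append if_False)
    qed
    ultimately show ?thesis using False Suc by simp
  qed
qed

lemma left_strand_L_word:
  assumes "p < 6 * t + 2"
  shows "left_strand (L_word t) p = (if p mod 6 = 0 then 1 else if p mod 6 = 1 then 3 else 2)"
    and "L_word t ! p > 0"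
proof -
  have "p mod 6 < 6" by simp
  then have "p mod 6 = 0 \<or> p mod 6 = 1 \<or> p mod 6 = 2 \<or> p mod 6 = 3 \<or> p mod 6 = 4 \<or> p mod 6 = 5"
    by linarith
  then show "left_strand (L_word t) p = (if p mod 6 = 0 then 1 else if p mod 6 = 1 then 3 else 2)"
    and "L_word t ! p > 0"
    by (auto simp: left_strand_def nth_L_word[OF assms])
qed

interpretation L_word: braid_word 4 "L_word t" for t
  by standard (auto simp: length_L_word left_strand_L_word)

lemma vertical_L_word: "p < 6 * t + 2 \<Longrightarrow> vertical_smoothing (L_word t) \<rho> p \<longleftrightarrow> p \<notin> \<rho>"
  using left_strand_L_word(2)[of p t] by (simp add: vertical_smoothing_def)

text \<open>Block \<open>m\<close> starts at position \<open>6 * m\<close> with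
  \<open>\<sigma>\<^sub>1\<close> and \<open>\<sigma>\<^sub>3\<close>, and its twist region is at
  the four positions from \<open>6 * m + 2\<close> on. So for \<open>c m < 4\<close> the value
  \<open>c m\<close> picks one letter of that region to receive the 0-smoothing.\<close>

definition missing :: "nat set \<Rightarrow> (nat \<Rightarrow> nat) \<Rightarrow> nat set" where
  "missing S c = (\<lambda>m. 6 * m + 2 + c m) ` S"

definition vertex :: "nat \<Rightarrow> nat set \<Rightarrow> (nat \<Rightarrow> nat) \<Rightarrow> nat set" where
  "vertex t S c = {..<6 * t + 2} - missing S c"

text \<open>The index of the last \<open>\<sigma>\<^sub>1\<close> (for strands 1 and 2) or
  \<open>\<sigma>\<^sub>3\<close> (for strands 3 and 4) before the point. Through the closure,
  points preceding the first such letter belong to the final one, which has index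
  \<open>t\<close>.\<close>

fun block_of :: "nat \<Rightarrow> point \<Rightarrow> nat" where
  "block_of t (q, s) =
     (if s \<le> 2 then if q = 0 then t else (q - 1) div 6 else if q \<le> 1 then t else (q - 2) div 6)"

fun ring_pos :: "point \<Rightarrow> nat" where
  "ring_pos (q, s) = (if (s = 2 \<or> s = 3) \<and> 3 \<le> q mod 6 then q mod 6 - 2 else 0)"

text \<open>
  In the resolution with only 1-smoothings, the four circles met by the twist region of a block
  form a ring, numbered by \<open>ring_pos\<close>, with number 0 for the circle that leaves the region. The
  letter \<open>6 * m + 2 + j\<close> joins the numbers \<open>j\<close> and \<open>(j + 1) mod 4\<close>, so a block with that letter
  missing identifies these two.
\<close>

definition label :: "nat \<Rightarrow> nat set \<Rightarrow> (nat \<Rightarrow> nat) \<Rightarrow> point \<Rightarrow> nat \<times> nat" where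
  "label t S c x = (block_of t x,
     if block_of t x \<in> S \<and> ring_pos x = (c (block_of t x) + 1) mod 4 then c (block_of t x) else ring_pos x)"

lemma label_eqI: "block_of t x = block_of t y \<Longrightarrow> ring_pos x = ring_pos y \<Longrightarrow> label t S c x = label t S c y"
  by (simp add: label_def)

lemma six_cases:
  fixes p :: nat
  obtains m where "p = 6 * m" | m where "p = 6 * m + 1" | m j where "p = 6 * m + 2 + j" "j < 4"
proof -
  have *: "p = 6 * (p div 6) + p mod 6" "p mod 6 < 6" by simp_all
  consider "p mod 6 = 0" | "p mod 6 = 1" | "2 \<le> p mod 6" by linarith
  then show ?thesis
  proof cases
    case 1
    then show ?thesis using that(1)[of "p div 6"] * by linarith
  next
    case 2
    then show ?thesis using that(2)[of "p div 6"] * by linarith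
  next
    case 3
    then have "p = 6 * (p div 6) + 2 + (p mod 6 - 2)" "p mod 6 - 2 < 4" using * by linarith+
    then show ?thesis using that(3) by blast
  qed
qed

text \<open>The case \<open>j = 4\<close> is included: the point just after the last twist letter
  lies on the circle with number 0 again.\<close>

lemma ring_pos_twist:
  assumes "j \<le> 4" "s = 2 \<or> s = 3"
  shows "ring_pos (6 * m + 2 + j, s) = j mod 4" "block_of t (6 * m + 2 + j, s) = m"
proof -
  define q where "q = 6 * m + 2 + j"
  have "q mod 6 = (if j = 4 then 0 else j + 2)" "(q - 1) div 6 = m" "(q - 2) div 6 = m" "q \<ge> 2"
    "j mod 4 = (if j = 4 then 0 else j)"
    using assms(1) unfolding q_def by presburger+
  then show "ring_pos (6 * m + 2 + j, s) = j mod 4" "block_of t (6 * m + 2 + j, s) = m"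
    using assms(2) unfolding q_def[symmetric] by auto
qed

text \<open>Labels are constant along arcs, so different labels certify different circles. Closure,
  passing and horizontal arcs preserve block and ring number. Only the vertical arcs of a missing
  letter change the ring number, between \<open>c m\<close> and \<open>(c m + 1) mod 4\<close>, and
  \<open>label\<close> identifies exactly these two.\<close>

lemma label_arc:
  assumes c: "\<And>m. m \<in> S \<Longrightarrow> c m < 4"
    and "arc 4 (L_word t) (vertex t S c) x y"
  shows "label t S c x = label t S c y"
  using assms(2)
proof (induction rule: arc.induct)
  case (closure s)
  have "(6 * t + 1) div 6 = t" "(6 * t + 2) mod 6 = 2" by presburger+
  then show ?case by (intro label_eqI) (auto simp: length_L_word)
next
  case (passing p s)
  then have p: "p < 6 * t + 2" by (simp add: length_L_word)
  show ?case
  proof (cases p rule: six_cases)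
    case (1 m)
    then have "s = 3 \<or> s = 4" using passing p by (auto simp: left_strand_L_word)
    moreover have "(6 * m - 1) div 6 = (6 * m - 2) div 6" "(6 * m) mod 6 = 0" "(6 * m + 1) mod 6 = 1"
      by presburger+
    ultimately show ?thesis using 1 p by (intro label_eqI) auto
  next
    case (2 m)
    then have "s = 1 \<or> s = 2" using passing p by (auto simp: left_strand_L_word mod_Suc)
    moreover have "(6 * m) div 6 = m" "(6 * m + 1) div 6 = m" "(6 * m + 2) mod 6 = 2" "(6 * m + 1) mod 6 = 1"
      by presburger+
    ultimately show ?thesis using 2 p by (intro label_eqI) auto
  next
    case (3 m j)
    then have "p mod 6 \<ge> 2" by presburger
    then have "s = 1 \<or> s = 4" using passing p by (auto simp: left_strand_L_word)
    moreover have "(6 * m + j + 1) div 6 = m" "(6 * m + j + 2) div 6 = m" "(6 * m + j) div 6 = m" 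
      using 3 by presburger+
    ultimately show ?thesis using 3 p by (intro label_eqI) (auto simp: algebra_simps)
  qed
next
  case (vertical p s)
  then have p: "p < 6 * t + 2" by (simp add: length_L_word)
  with vertical obtain m where m: "m \<in> S" "p = 6 * m + 2 + c m"
    by (auto simp: vertical_L_word vertex_def missing_def)
  have "p mod 6 \<ge> 2" using m c[OF m(1)] by presburger
  then have s: "s = 2 \<or> s = 3" using vertical p by (auto simp: left_strand_L_word)
  show ?case
    using ring_pos_twist(1)[of "c m" s m] ring_pos_twist(1)[of "c m + 1" s m]
      ring_pos_twist(2)[of "c m" s t m] ring_pos_twist(2)[of "c m + 1" s t m] c[OF m(1)] m s
    by (simp add: label_def del: ring_pos.simps block_of.simps)
next
  case (horizontal p q)
  then have p: "p < 6 * t + 2" by (simp add: length_L_word)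
  show ?case
  proof (cases p rule: six_cases)
    case (1 m)
    then have "left_strand (L_word t) p = 1" using p by (auto simp: left_strand_L_word)
    moreover have "(6 * m) mod 6 = 0" "(6 * m + 1) mod 6 = 1" by presburger+
    ultimately show ?thesis using 1 horizontal by (intro label_eqI) auto
  next
    case (2 m)
    then have "left_strand (L_word t) p = 3" using p by (auto simp: left_strand_L_word mod_Suc)
    moreover have "(6 * m + 1) mod 6 = 1" "(6 * m + 2) mod 6 = 2" by presburger+
    ultimately show ?thesis using 2 horizontal by (intro label_eqI) auto
  next
    case (3 m j)
    then have "p mod 6 \<ge> 2" by presburger
    then have "left_strand (L_word t) p = 2" using p by (auto simp: left_strand_L_word)
    moreover obtain i where "q = 6 * m + 2 + i" "i \<le> 4"
      using 3 horizontal by (metis Suc_eq_plus1 Suc_leI add_Suc_right nat_less_le)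
    ultimately show ?thesis
      using ring_pos_twist(1)[of i 2 m] ring_pos_twist(1)[of i 3 m]
        ring_pos_twist(2)[of i 2 t m] ring_pos_twist(2)[of i 3 t m]
      by (intro label_eqI) (auto simp del: ring_pos.simps block_of.simps)
  qed
qed

lemma circle_of_eq_imp_label:
  assumes "\<And>m. m \<in> S \<Longrightarrow> c m < 4"
    and "circle_of 4 (L_word t) (vertex t S c) x = circle_of 4 (L_word t) (vertex t S c) y"
  shows "label t S c x = label t S c y"
proof -
  have "equivclp (arc 4 (L_word t) (vertex t S c)) x y" using assms by (simp add: circle_of_eq_iff)
  then show ?thesis by (induction rule: equivclp_induct) (use label_arc[OF assms(1)] in auto)
qed

text \<open>The forest property. At a \<open>\<sigma>\<^sub>1\<close> or
  \<open>\<sigma>\<^sub>3\<close> the block changes, cyclically among \<open>t + 1 \<ge> 2\<close>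
  values. At a twist letter the ring numbers are adjacent on a 4-cycle, and contracting at most one
  other edge of the cycle keeps them apart.\<close>

lemma ends_apart:
  assumes c: "\<And>m. m \<in> S \<Longrightarrow> c m < 4" and "t \<ge> 1" and "p \<in> vertex t S c"
  defines "\<rho> \<equiv> vertex t S c" and "i \<equiv> left_strand (L_word t) p"
  shows "circle_of 4 (L_word t) \<rho> (p, i) \<noteq> circle_of 4 (L_word t) \<rho> (p + 1, i)"
proof -
  have p: "p < 6 * t + 2" and pM: "p \<notin> missing S c" using assms by (auto simp: vertex_def)
  have "label t S c (p, i) \<noteq> label t S c (p + 1, i)"
  proof (cases p rule: six_cases)
    case (1 m)
    then have "i = 1" using p by (simp add: i_def left_strand_L_word)
    moreover have "m > 0 \<Longrightarrow> (6 * m - 1) div 6 = m - 1" by presburger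
    ultimately have "block_of t (p, i) \<noteq> block_of t (p + 1, i)" using 1 \<open>t \<ge> 1\<close> by (cases m) auto
    then show ?thesis by (simp add: label_def del: block_of.simps)
  next
    case (2 m)
    then have "i = 3" using p by (simp add: i_def left_strand_L_word mod_Suc)
    moreover have "m > 0 \<Longrightarrow> (6 * m - 1) div 6 = m - 1" by presburger
    ultimately have "block_of t (p, i) \<noteq> block_of t (p + 1, i)" using 2 \<open>t \<ge> 1\<close> by (cases m) auto
    then show ?thesis by (simp add: label_def del: block_of.simps)
  next
    case (3 m j)
    then have "p mod 6 \<ge> 2" by presburger
    then have i: "i = 2" using p by (simp add: i_def left_strand_L_word)
    have j: "m \<in> S \<Longrightarrow> c m \<noteq> j" using 3 pM by (auto simp: missing_def)
    have "(j + 1) mod 4 \<noteq> (c m + 1) mod 4" "j = (c m + 1) mod 4 \<Longrightarrow> c m \<noteq> (j + 1) mod 4"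
      if "m \<in> S"
      using j[OF that] c[OF that] \<open>j < 4\<close> by presburger+
    moreover have "j \<noteq> (j + 1) mod 4" by presburger
    moreover have "ring_pos (p, i) = j" "block_of t (p, i) = m"
      using ring_pos_twist(1)[of j 2 m] ring_pos_twist(2)[of j 2 t m] 3 i by simp_all
    moreover have "ring_pos (p + 1, i) = (j + 1) mod 4" "block_of t (p + 1, i) = m"
      using ring_pos_twist(1)[of "j + 1" 2 m] ring_pos_twist(2)[of "j + 1" 2 t m] 3 i
      by (simp_all only: add.assoc) auto
    ultimately show ?thesis unfolding label_def by auto
  qed
  moreover have "label t S c x = label t S c y"
    if "circle_of 4 (L_word t) \<rho> x = circle_of 4 (L_word t) \<rho> y" for x y
    using c that unfolding \<rho>_def by (rule circle_of_eq_imp_label)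
  ultimately show ?thesis by blast
qed

text \<open>The path uses the cup-cap structure of two consecutive \<open>\<sigma>\<^sub>1\<close>:
  from strand 2 to strand 1 at position \<open>6 * m + 6\<close>, back along strand 1 past the whole
  twist region, and over to strand 2 after the \<open>\<sigma>\<^sub>1\<close> at
  \<open>6 * m\<close>. For the last block the second \<open>\<sigma>\<^sub>1\<close> is the one
  that ends the word together with \<open>\<sigma>\<^sub>3\<close>.\<close>

lemma ring_closes:
  assumes "m < t" "m \<notin> S" and c: "\<And>m. m \<in> S \<Longrightarrow> c m < 4"
  defines "\<rho> \<equiv> vertex t S c"
  shows "circle_of 4 (L_word t) \<rho> (6 * m + 6, 2) = circle_of 4 (L_word t) \<rho> (6 * m + 2, 2)"
proof -
  let ?E = "equivclp (arc 4 (L_word t) \<rho>)"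
  have in_\<rho>: "p \<in> \<rho>" if "p < 6 * t + 2" "p mod 6 < 2" for p
  proof -
    have "p \<noteq> 6 * m + 2 + c m" if "m \<in> S" for m
      using c[OF that] \<open>p mod 6 < 2\<close> by presburger
    then show ?thesis using that by (auto simp: \<rho>_def vertex_def missing_def)
  qed
  have strand: "?E (6 * m + 1, 1) (6 * m + 1 + k, 1)" if "k \<le> 5" for k
    using that
  proof (induction k)
    case (Suc k)
    let ?p = "6 * m + 1 + k"
    have p: "?p < length (L_word t)" "?p < 6 * t + 2" using Suc \<open>m < t\<close> by (auto simp: length_L_word)
    have "?p mod 6 \<noteq> 0" using Suc by presburger
    then have "left_strand (L_word t) ?p \<noteq> 1" "left_strand (L_word t) ?p \<noteq> 0"
      using left_strand_L_word[OF p(2)] by auto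
    then have "arc 4 (L_word t) \<rho> (?p, 1) (?p + 1, 1)"
      by (intro arc.passing p) auto
    then show ?case using Suc by (auto intro: equivclp_into_equivclp)
  qed simp
  have cap: "?E (q, 1) (q, 2)" if "p < 6 * t + 2" "p mod 6 = 0" "q = p \<or> q = p + 1" for p q
  proof -
    have "left_strand (L_word t) p = 1" using that left_strand_L_word by simp
    moreover have "\<not> vertical_smoothing (L_word t) \<rho> p" using that in_\<rho> vertical_L_word by auto
    ultimately show ?thesis
      using arc.horizontal[of p "L_word t" \<rho> q 4] that by (auto simp: length_L_word numeral_2_eq_2)
  qed
  have "?E (6 * m + 6, 2) (6 * m + 6, 1)"
    using cap[of "6 * m + 6" "6 * m + 6"] \<open>m < t\<close> by (auto intro: equivclp_sym)
  also have "?E (6 * m + 6, 1) (6 * m + 1, 1)" using equivclp_sym[OF strand[of 5]] by (simp add: add.commute)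
  also have "?E (6 * m + 1, 1) (6 * m + 1, 2)" using cap[of "6 * m" "6 * m + 1"] \<open>m < t\<close> by auto
  also have "?E (6 * m + 1, 2) (6 * m + 2, 2)"
  proof -
    have p: "6 * m + 1 < 6 * t + 2" using \<open>m < t\<close> by simp
    have "(6 * m + 1) mod 6 = 1" by presburger
    then have "left_strand (L_word t) (6 * m + 1) = 3" using left_strand_L_word[OF p] by simp
    then have "arc 4 (L_word t) \<rho> (6 * m + 1, 2) (6 * m + 1 + 1, 2)"
      using p by (intro arc.passing) (auto simp: length_L_word)
    then show ?thesis by auto
  qed
  finally show ?thesis by (simp add: circle_of_eq_iff)
qed

section \<open>The cycles\<close>

abbreviation full_state :: "nat \<Rightarrow> nat set \<Rightarrow> (nat \<Rightarrow> nat) \<Rightarrow> state" where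
  "full_state t S c \<equiv> (vertex t S c, circles 4 (L_word t) (vertex t S c))"

text \<open>Extensional functions, so that choices agreeing on \<open>S\<close> are equal and no
  state is counted twice in \<open>twist_cycle\<close>.\<close>

definition twist_choices :: "nat set \<Rightarrow> (nat \<Rightarrow> nat) set" where
  "twist_choices S = (\<Pi>\<^sub>E m\<in>S. {..<4})"

definition twist_cycle :: "nat \<Rightarrow> nat set \<Rightarrow> (state \<Rightarrow>\<^sub>0 int)" where
  "twist_cycle t S = (\<Sum>c\<in>twist_choices S. frag_of (full_state t S c))"

text \<open>By \<open>ends_apart\<close> the merge lemmas apply to every crossing of the vertex.
  Read backwards, the edge of the cube from \<open>\<rho> - {p}\<close> to \<open>\<rho>\<close>
  splits \<open>u \<union> v\<close> into \<open>u\<close> and \<open>v\<close>.\<close>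

lemma circles_remove:
  assumes "\<And>m. m \<in> S \<Longrightarrow> c m < 4" and "t \<ge> 1" and p: "p \<in> vertex t S c"
  defines "\<rho> \<equiv> vertex t S c"
  defines "u \<equiv> circle_of 4 (L_word t) \<rho> (p, left_strand (L_word t) p)"
    and "v \<equiv> circle_of 4 (L_word t) \<rho> (p + 1, left_strand (L_word t) p)"
  shows "circles 4 (L_word t) (\<rho> - {p}) - circles 4 (L_word t) \<rho> = {u \<union> v}"
    and "circles 4 (L_word t) \<rho> - circles 4 (L_word t) (\<rho> - {p}) = {u, v}"
    and "u \<noteq> v" and "u \<in> circles 4 (L_word t) \<rho>" and "v \<in> circles 4 (L_word t) \<rho>"
proof -
  have len: "p < length (L_word t)" using p by (simp add: vertex_def length_L_word)
  have "\<not> vertical_smoothing (L_word t) \<rho> p" "vertical_smoothing (L_word t) (\<rho> - {p}) p"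
    using len p by (auto simp: vertical_L_word length_L_word \<rho>_def)
  moreover have "vertical_smoothing (L_word t) (\<rho> - {p}) q = vertical_smoothing (L_word t) \<rho> q"
    if "q < length (L_word t)" "q \<noteq> p" for q
    using that by (auto simp: vertical_L_word length_L_word)
  moreover have "circle_of 4 (L_word t) \<rho> (p, left_strand (L_word t) p)
      \<noteq> circle_of 4 (L_word t) \<rho> (p + 1, left_strand (L_word t) p)"
    unfolding \<rho>_def using assms(1-3) by (rule ends_apart)
  ultimately show "circles 4 (L_word t) (\<rho> - {p}) - circles 4 (L_word t) \<rho> = {u \<union> v}"
    and "circles 4 (L_word t) \<rho> - circles 4 (L_word t) (\<rho> - {p}) = {u, v}"
    and "u \<noteq> v" and "u \<in> circles 4 (L_word t) \<rho>" and "v \<in> circles 4 (L_word t) \<rho>"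
    unfolding u_def v_def using len L_word.circles_merge[of p t \<rho> "\<rho> - {p}"] by blast+
qed

section \<open>Coefficients that vanish on boundaries\<close>

lemma edge_map_split:
  assumes "insert p \<rho> = \<rho>'" and "circles b w \<rho> - circles b w \<rho>' = {a}"
    and "circles b w \<rho>' - circles b w \<rho> = {u, v}" and "u \<noteq> v"
  shows "edge_map b w p (\<rho>, P) =
    (if a \<in> P then frag_of (\<rho>', insert u (P - {a})) + frag_of (\<rho>', insert v (P - {a}))
     else frag_of (\<rho>', P))"
  using assms(4) by (simp add: edge_map_def Let_def assms(1-3))

text \<open>An edge ending at this vertex is a split. Neither \<open>u\<close> nor \<open>v\<close>
  is a circle of the source, so neither lies in \<open>P\<close>, and the split adds at most one of
  them: the other carries \<open>v\<^sub>-\<close>.\<close>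

lemma lookup_edge_map_full_state:
  assumes c: "\<And>m. m \<in> S \<Longrightarrow> c m < 4" and t: "t \<ge> 1"
    and p: "p \<notin> \<rho>" and P: "P \<subseteq> circles 4 (L_word t) \<rho>"
  shows "Poly_Mapping.lookup (edge_map 4 (L_word t) p (\<rho>, P)) (full_state t S c) = 0"
proof (cases "insert p \<rho> = vertex t S c")
  case False
  then show ?thesis by (simp add: edge_map_def Let_def lookup_sum lookup_single when_def)
next
  case True
  then have \<rho>: "\<rho> = vertex t S c - {p}" and pv: "p \<in> vertex t S c" using p by auto
  let ?C = "circles 4 (L_word t) (vertex t S c)" and ?C' = "circles 4 (L_word t) \<rho>"
  obtain u v where uv: "?C' - ?C = {u \<union> v}" "?C - ?C' = {u, v}" "u \<noteq> v"
    by (rule that[OF circles_remove(1-3)[OF c t pv, folded \<rho>]])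
  have "u \<in> ?C - ?C'" "v \<in> ?C - ?C'" unfolding uv(2) by simp_all
  then have mem: "u \<in> ?C" "v \<in> ?C" "u \<notin> P" "v \<notin> P" using P by blast+
  have "v \<notin> insert u (P - {u \<union> v})" "u \<notin> insert v (P - {u \<union> v})" using mem uv(3) by auto
  then have no: "insert u (P - {u \<union> v}) \<noteq> ?C" "insert v (P - {u \<union> v}) \<noteq> ?C" and no': "P \<noteq> ?C"
    using mem by metis+
  show ?thesis
    using no no' unfolding edge_map_split[OF True uv]
    by (auto simp: lookup_add lookup_single when_def)
qed

lemma lookup_differential_full_state:
  assumes "\<And>m. m \<in> S \<Longrightarrow> c m < 4" and "t \<ge> 1"
    and y: "Poly_Mapping.keys y \<subseteq> states 4 (L_word t)"
  shows "Poly_Mapping.lookup (differential 4 (L_word t) y) (full_state t S c) = 0"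
proof -
  have "Poly_Mapping.lookup (state_differential 4 (L_word t) x) (full_state t S c) = 0"
    if "x \<in> states 4 (L_word t)" for x
    unfolding state_differential_def
    using that lookup_edge_map_full_state[OF assms(1,2)]
    by (auto simp: lookup_sum states_def intro!: sum.neutral)
  then show ?thesis
    using y by (auto simp: differential_def frag_extend_def lookup_sum intro!: sum.neutral)
qed

section \<open>Cancellation along one twist region\<close>

lemma vertex_insert:
  assumes "m \<notin> S"
  shows "vertex t (insert m S) (c(m := j)) = vertex t S c - {6 * m + 2 + j}"
proof -
  have "missing (insert m S) (c(m := j)) = insert (6 * m + 2 + j) (missing S c)"
    using assms unfolding missing_def by (auto simp: image_iff)
  then show ?thesis by (auto simp: vertex_def)
qed

lemma twist_letter_in_vertex:
  assumes "m < t" "m \<notin> S" "j < 4" and c: "\<And>m. m \<in> S \<Longrightarrow> c m < 4"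
  shows "6 * m + 2 + j \<in> vertex t S c"
proof -
  have "6 * m + 2 + j \<noteq> 6 * m' + 2 + c m'" if "m' \<in> S" for m'
  proof
    assume "6 * m + 2 + j = 6 * m' + 2 + c m'"
    then have "m = m'" using c[OF that] \<open>j < 4\<close> by presburger
    then show False using that \<open>m \<notin> S\<close> by simp
  qed
  then show ?thesis using assms by (auto simp: vertex_def missing_def)
qed

text \<open>\<open>D i\<close> has \<open>v\<^sub>-\<close> only at the circle through ring position
  \<open>i\<close>. Splitting a circle labelled \<open>v\<^sub>+\<close> puts
  \<open>v\<^sub>-\<close> on either of the two new circles, which are the ends of the edge
  \<open>j\<close> of the ring.\<close>

lemma edge_map_full_state:
  assumes m: "m < t" "m \<notin> S" and j: "j < 4" and c: "\<And>m. m \<in> S \<Longrightarrow> c m < 4"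
  defines "\<rho> \<equiv> vertex t S c"
  defines "D \<equiv> \<lambda>i. frag_of (\<rho>, circles 4 (L_word t) \<rho> - {circle_of 4 (L_word t) \<rho> (6 * m + 2 + i, 2)})"
  shows "edge_map 4 (L_word t) (6 * m + 2 + j) (full_state t (insert m S) (c(m := j))) = D j + D (j + 1)"
proof -
  let ?p = "6 * m + 2 + j" and ?C = "circles 4 (L_word t) \<rho>"
  let ?C' = "circles 4 (L_word t) (\<rho> - {?p})"
  let ?u = "circle_of 4 (L_word t) \<rho> (?p, 2)" and ?v = "circle_of 4 (L_word t) \<rho> (?p + 1, 2)"
  have p: "?p \<in> \<rho>" unfolding \<rho>_def using m j c by (rule twist_letter_in_vertex)
  have t: "t \<ge> 1" using m by simp
  have "?p < 6 * t + 2" using p by (auto simp: \<rho>_def vertex_def)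
  moreover have "?p mod 6 \<ge> 2" using j by presburger
  ultimately have strand: "left_strand (L_word t) ?p = 2" by (simp add: left_strand_L_word)
  note rem = circles_remove[OF c t p[unfolded \<rho>_def], folded \<rho>_def, unfolded strand]
  have ins: "insert ?p (\<rho> - {?p}) = \<rho>" using p by auto
  have "insert ?u (?C' - {?u \<union> ?v}) = ?C - {?v}" "insert ?v (?C' - {?u \<union> ?v}) = ?C - {?u}"
    "?u \<union> ?v \<in> ?C'"
    using rem by blast+
  then have "edge_map 4 (L_word t) ?p (\<rho> - {?p}, ?C') = frag_of (\<rho>, ?C - {?v}) + frag_of (\<rho>, ?C - {?u})"
    using edge_map_split[OF ins rem(1-3), of ?C'] by (simp only: if_True)
  then show ?thesis
    unfolding vertex_insert[OF m(2)] D_def \<rho>_def[symmetric] by (simp add: add.commute add.assoc)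
qed

lemma sum_PiE_insert:
  assumes "m \<notin> S"
  shows "sum g (PiE (insert m S) B) = (\<Sum>c\<in>PiE S B. \<Sum>j\<in>B m. g (c(m := j)))"
proof -
  have "sum g (PiE (insert m S) B) = (\<Sum>(j, c)\<in>B m \<times> PiE S B. g (c(m := j)))"
    unfolding PiE_insert_eq by (subst sum.reindex[OF inj_combinator[OF assms]]) (simp add: case_prod_unfold)
  also have "\<dots> = (\<Sum>j\<in>B m. \<Sum>c\<in>PiE S B. g (c(m := j)))" by (rule sum.cartesian_product[symmetric])
  also have "\<dots> = (\<Sum>c\<in>PiE S B. \<Sum>j\<in>B m. g (c(m := j)))" by (rule sum.swap)
  finally show ?thesis .
qed

text \<open>The signs alternate along the ring, so the sum of the edge terms
  \<open>D j + D (j + 1)\<close> telescopes to its first and last terms, which cancel because the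
  ring closes up after an even number of letters.\<close>

lemma twist_sum_zero:
  assumes m: "m < t" "m \<notin> S" and c: "\<And>m. m \<in> S \<Longrightarrow> c m < 4"
  shows "(\<Sum>j<4. let p = 6 * m + 2 + j; x = full_state t (insert m S) (c(m := j))
      in frag_cmul ((-1) ^ card {q \<in> fst x. q < p}) (edge_map 4 (L_word t) p x)) = 0"
proof -
  define \<rho> where "\<rho> = vertex t S c"
  define D where
    "D = (\<lambda>i. frag_of (\<rho>, circles 4 (L_word t) \<rho> - {circle_of 4 (L_word t) \<rho> (6 * m + 2 + i, 2)}))"
  define K where "K = card {q \<in> \<rho>. q < 6 * m + 2}"
  have edge: "edge_map 4 (L_word t) (6 * m + 2 + j) (full_state t (insert m S) (c(m := j))) = D j + D (j + 1)"
    if "j < 4" for j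
    unfolding D_def \<rho>_def using m that c by (rule edge_map_full_state)
  \<comment> \<open>The \<open>j\<close> twist letters of the block before the missing one all have
    the 1-smoothing, so each contributes one factor to the sign; \<open>K\<close> counts the
    crossings before the twist region.\<close>
  have sign: "card {q \<in> vertex t (insert m S) (c(m := j)). q < 6 * m + 2 + j} = K + j" if j: "j < 4" for j
  proof -
    have "6 * m + 2 + i \<in> \<rho>" if "i < j" for i
      unfolding \<rho>_def using that j c by (intro twist_letter_in_vertex m) auto
    then have "{6 * m + 2..<6 * m + 2 + j} \<subseteq> \<rho>"
      by (auto simp: nat_le_iff_add algebra_simps)
    then have "{q \<in> vertex t (insert m S) (c(m := j)). q < 6 * m + 2 + j}
        = {q \<in> \<rho>. q < 6 * m + 2} \<union> {6 * m + 2..<6 * m + 2 + j}"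
      unfolding vertex_insert[OF m(2)] \<rho>_def[symmetric] by auto
    moreover have "finite {q \<in> \<rho>. q < 6 * m + 2}" by simp
    ultimately show ?thesis unfolding K_def by (simp add: card_Un_disjoint disjoint_iff)
  qed
  have "(\<Sum>j<4. let p = 6 * m + 2 + j; x = full_state t (insert m S) (c(m := j))
      in frag_cmul ((-1) ^ card {q \<in> fst x. q < p}) (edge_map 4 (L_word t) p x))
    = (\<Sum>j<4. frag_cmul ((-1) ^ (K + j)) (D j + D (j + 1)))"
    by (intro sum.cong refl) (simp only: Let_def fst_conv edge sign lessThan_iff)
  also have "\<dots> = (\<Sum>j<4. frag_cmul ((-1) ^ (K + j)) (D j) - frag_cmul ((-1) ^ (K + Suc j)) (D (Suc j)))"
    by (intro sum.cong refl) (simp add: frag_cmul_distrib2)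
  also have "\<dots> = frag_cmul ((-1) ^ K) (D 0) - frag_cmul ((-1) ^ (K + 4)) (D 4)"
    by (subst sum_lessThan_telescope') simp
  also have "D 4 = D 0"
    unfolding D_def \<rho>_def using ring_closes[OF m c] by (simp add: algebra_simps)
  also have "frag_cmul ((-1) ^ K) (D 0) - frag_cmul ((-1) ^ (K + 4)) (D 0) = 0"
    by (simp add: power_add)
  finally show ?thesis .
qed

section \<open>The differential of the twist cycles\<close>

lemma twist_choices_less: "c \<in> twist_choices S \<Longrightarrow> m \<in> S \<Longrightarrow> c m < 4"
  by (auto simp: twist_choices_def)

lemma missing_subset:
  assumes "S \<subseteq> {..<t}" and "\<And>m. m \<in> S \<Longrightarrow> c m < 4"
  shows "missing S c \<subseteq> {..<6 * t + 2}"
proof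
  fix p assume "p \<in> missing S c"
  then obtain m where "m \<in> S" "p = 6 * m + 2 + c m" by (auto simp: missing_def)
  moreover have "m < t" "c m < 4" using assms \<open>m \<in> S\<close> by auto
  ultimately show "p \<in> {..<6 * t + 2}" by simp
qed

lemma missing_inj:
  fixes c :: "nat \<Rightarrow> nat"
  assumes "\<And>m. m \<in> S \<Longrightarrow> c m < 4"
  shows "inj_on (\<lambda>m. 6 * m + 2 + c m) S"
proof (rule inj_onI)
  fix x y assume "x \<in> S" "y \<in> S" "6 * x + 2 + c x = 6 * y + 2 + c y"
  then show "x = y" using assms[of x] assms[of y] by presburger
qed

lemma differential_twist_cycle:
  assumes S: "S \<subseteq> {..<t}"
  shows "differential 4 (L_word t) (twist_cycle t S) = 0"
proof -
  have fin: "finite S" using S finite_subset by blast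
  then have "finite (twist_choices S)" by (simp add: twist_choices_def finite_PiE)
  define F where "F = (\<lambda>m c. let p = 6 * m + 2 + c m; x = full_state t S c
      in frag_cmul ((-1) ^ card {q \<in> fst x. q < p}) (edge_map 4 (L_word t) p x))"
  have "differential 4 (L_word t) (twist_cycle t S)
      = (\<Sum>c\<in>twist_choices S. state_differential 4 (L_word t) (full_state t S c))"
    by (simp add: differential_def twist_cycle_def frag_extend_sum \<open>finite (twist_choices S)\<close>)
  also have "\<dots> = (\<Sum>c\<in>twist_choices S. \<Sum>m\<in>S. F m c)"
  proof (intro sum.cong refl)
    fix c assume c: "c \<in> twist_choices S"
    \<comment> \<open>The crossings that can still be changed are the missing ones, one in each
      block of \<open>S\<close>, so the differential becomes a sum over \<open>S\<close>.\<close>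
    have "{..<length (L_word t)} - vertex t S c = (\<lambda>m. 6 * m + 2 + c m) ` S"
      using missing_subset[where c = c, OF S twist_choices_less[OF c]]
      by (auto simp: vertex_def length_L_word missing_def)
    then show "state_differential 4 (L_word t) (full_state t S c) = (\<Sum>m\<in>S. F m c)"
      unfolding state_differential_def fst_conv F_def Let_def
      by (simp only: sum.reindex[OF missing_inj[where c = c, OF twist_choices_less[OF c]]] o_def)
  qed
  also have "\<dots> = (\<Sum>m\<in>S. \<Sum>c\<in>twist_choices S. F m c)" by (rule sum.swap)
  also have "\<dots> = 0"
  proof (rule sum.neutral, rule ballI)
    fix m assume "m \<in> S"
    then have S': "S = insert m (S - {m})" "m \<notin> S - {m}" "m < t" using S by auto
    \<comment> \<open>With the choices in the other blocks fixed, the four choices in block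
      \<open>m\<close> run once around its ring.\<close>
    have "(\<Sum>c\<in>twist_choices S. F m c)
        = (\<Sum>c\<in>twist_choices (S - {m}). \<Sum>j<4. F m (c(m := j)))"
      unfolding twist_choices_def by (subst S'(1)) (rule sum_PiE_insert[OF S'(2)])
    also have "\<dots> = 0"
    proof (rule sum.neutral, rule ballI)
      fix c assume "c \<in> twist_choices (S - {m})"
      then have "\<And>m'. m' \<in> S - {m} \<Longrightarrow> c m' < 4" by (rule twist_choices_less)
      from twist_sum_zero[OF S'(3,2) this] show "(\<Sum>j<4. F m (c(m := j))) = 0"
        unfolding F_def S'(1)[symmetric] by simp
    qed
    finally show "(\<Sum>c\<in>twist_choices S. F m c) = 0" .
  qed
  finally show ?thesis .
qed

text \<open>Since \<open>c m < 4\<close>, a position \<open>6 * m + 2 + c m\<close> determines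
  \<open>m\<close> and \<open>c m\<close>. So the set of missing letters determines \<open>S\<close>
  and the values of \<open>c\<close> on it, and extensionality does the rest.\<close>

lemma vertex_eq_imp:
  assumes "S \<subseteq> {..<t}" "S' \<subseteq> {..<t}" "c \<in> twist_choices S" "c' \<in> twist_choices S'"
    and eq: "vertex t S c = vertex t S' c'"
  shows "S = S' \<and> c = c'"
proof -
  have sub: "m \<in> B \<and> b m = a m"
    if "A \<subseteq> {..<t}" "a \<in> twist_choices A" "b \<in> twist_choices B" "m \<in> A" "vertex t A a = vertex t B b"
    for A B a b m
  proof -
    note eq = \<open>vertex t A a = vertex t B b\<close>
    have "6 * m + 2 + a m \<notin> vertex t B b"
      using \<open>m \<in> A\<close> unfolding eq[symmetric] by (auto simp: vertex_def missing_def)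
    moreover have "6 * m + 2 + a m < 6 * t + 2"
      using missing_subset[where c = a, OF that(1) twist_choices_less[OF that(2)]] that(4)
      by (auto simp: missing_def)
    ultimately have "6 * m + 2 + a m \<in> missing B b" by (simp add: vertex_def)
    then obtain m' where m': "m' \<in> B" "6 * m + 2 + a m = 6 * m' + 2 + b m'"
      by (auto simp: missing_def)
    then have "m = m'"
      using twist_choices_less[OF that(2,4)] twist_choices_less[OF that(3) m'(1)] by presburger
    then show ?thesis using m' by simp
  qed
  have "S = S'" using sub[OF assms(1,3,4) _ eq] sub[OF assms(2,4,3) _ eq[symmetric]] by blast
  moreover have "c = c'"
  proof (rule PiE_ext)
    show "c \<in> PiE S (\<lambda>_. {..<4})" "c' \<in> PiE S (\<lambda>_. {..<4})"
      using assms(3,4) \<open>S = S'\<close> by (auto simp: twist_choices_def)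
    show "c m = c' m" if "m \<in> S" for m using sub[OF assms(1,3,4) that eq] by simp
  qed
  ultimately show ?thesis by simp
qed

text \<open>A single state of \<open>twist_cycle t S\<close> suffices to detect \<open>S\<close>;
  this one omits the first twist letter of each chosen block.\<close>

definition base_choice :: "nat set \<Rightarrow> nat \<Rightarrow> nat" where
  "base_choice S = (\<lambda>m\<in>S. 0)"

lemma base_choice: "base_choice S \<in> twist_choices S"
  by (simp add: base_choice_def twist_choices_def)

lemma lookup_twist_cycle:
  assumes "S \<subseteq> {..<t}" "S' \<subseteq> {..<t}"
  shows "Poly_Mapping.lookup (twist_cycle t S') (full_state t S (base_choice S)) = (if S' = S then 1 else 0)"
proof -
  have fin: "finite (twist_choices S')"
    using assms finite_subset by (auto simp: twist_choices_def intro!: finite_PiE)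
  have eq: "full_state t S' c = full_state t S (base_choice S) \<longleftrightarrow> S' = S \<and> c = base_choice S"
    if "c \<in> twist_choices S'" for c
    using vertex_eq_imp[OF assms(2,1) that base_choice] by auto
  have "Poly_Mapping.lookup (twist_cycle t S') (full_state t S (base_choice S))
      = (\<Sum>c\<in>twist_choices S'. if S' = S \<and> c = base_choice S then 1 else 0)"
    unfolding twist_cycle_def lookup_sum
    by (intro sum.cong refl) (simp only: lookup_single when_def eq)
  also have "\<dots> = (if S' = S then 1 else 0)"
    using fin base_choice[of S] by (cases "S' = S") simp_all
  finally show ?thesis .
qed

section \<open>Degrees of the twist cycles\<close>

lemma card_vertex:
  assumes "S \<subseteq> {..<t}" and c: "\<And>m. m \<in> S \<Longrightarrow> c m < 4"
  shows "card (vertex t S c) = 6 * t + 2 - card S"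
proof -
  have "card (missing S c) = card S" unfolding missing_def using missing_inj[OF c] by (rule card_image)
  then show ?thesis
    unfolding vertex_def using missing_subset[OF assms] finite_subset[OF missing_subset[OF assms]]
    by (simp add: card_Diff_subset)
qed

text \<open>Giving the missing letters their 0-smoothing one after another merges two circles each
  time. Hence the quantum degree of a full state depends on \<open>S\<close> only through
  \<open>card S\<close>.\<close>

lemma card_circles_vertex:
  assumes "S \<subseteq> {..<t}" and "\<And>m. m \<in> S \<Longrightarrow> c m < 4"
  shows "card (circles 4 (L_word t) (vertex t S c)) + card S = card (circles 4 (L_word t) {..<6 * t + 2})"
proof -
  have "finite S" using assms finite_subset by blast
  then show ?thesis using assms
  proof (induction S)
    case empty
    then show ?case by (simp add: vertex_def missing_def)
  next
    case (insert m S)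
    let ?C = "circles 4 (L_word t) (vertex t S c)" and ?p = "6 * m + 2 + c m"
    let ?C' = "circles 4 (L_word t) (vertex t (insert m S) c)"
    have c: "\<And>m. m \<in> S \<Longrightarrow> c m < 4" and t: "t \<ge> 1" using insert.prems by auto
    have p: "?p \<in> vertex t S c" using insert c by (intro twist_letter_in_vertex) auto
    have v: "vertex t (insert m S) c = vertex t S c - {?p}"
      using vertex_insert[OF insert.hyps(2), of t c "c m"] by simp
    obtain u v where uv: "?C' - ?C = {u \<union> v}" "?C - ?C' = {u, v}" "u \<noteq> v"
      by (rule that[OF circles_remove(1-3)[OF c t p, folded v]])
    have "card ?C' = card (?C' \<inter> ?C) + card (?C' - ?C)" "card ?C = card (?C \<inter> ?C') + card (?C - ?C')"
      by (rule card_Int_Diff[OF finite_circles])+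
    moreover have "card (?C \<inter> ?C') = card (?C' \<inter> ?C)" by (simp only: Int_commute)
    moreover have "card (?C' - ?C) = 1" "card (?C - ?C') = 2"
      unfolding uv(1,2) using uv(3) by simp_all
    ultimately have "card ?C = card ?C' + 1" by linarith
    then show ?case using insert by simp
  qed
qed

lemma n_neg_L_word: "n_neg (L_word t) = 0"
proof -
  have "{p. p < length (L_word t) \<and> L_word t ! p < 0} = {}"
    using left_strand_L_word(2)[of _ t] by (auto simp: length_L_word) (meson not_less_iff_gr_or_eq)
  then show ?thesis by (simp add: n_neg_def)
qed

definition twist_degree :: "nat \<Rightarrow> nat \<Rightarrow> int" where
  "twist_degree t k = int (card (circles 4 (L_word t) {..<6 * t + 2})) - int k
     + int (6 * t + 2 - k) + int (n_pos (L_word t))"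

lemma keys_twist_cycle:
  assumes S: "S \<subseteq> {..<t}"
  shows "Poly_Mapping.keys (twist_cycle t S) \<subseteq>
    {x \<in> states 4 (L_word t). homological_degree (L_word t) x = int (length (L_word t)) - int (card S)
      \<and> quantum_degree 4 (L_word t) x = twist_degree t (card S)}"
proof -
  have "Poly_Mapping.keys (twist_cycle t S) \<subseteq> (\<Union>c\<in>twist_choices S. {full_state t S c})"
    unfolding twist_cycle_def by (rule order_trans[OF keys_sum]) auto
  moreover have "full_state t S c \<in> {x \<in> states 4 (L_word t).
      homological_degree (L_word t) x = int (length (L_word t)) - int (card S)
      \<and> quantum_degree 4 (L_word t) x = twist_degree t (card S)}"
    if c: "c \<in> twist_choices S" for c
  proof -
    have "card S \<le> t" using card_mono[OF _ S] by simp
    then show ?thesis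
      using card_vertex[where c = c, OF S twist_choices_less[OF c]] card_circles_vertex[where c = c, OF S twist_choices_less[OF c]]
      by (auto simp: states_def vertex_def length_L_word n_neg_L_word twist_degree_def)
  qed
  ultimately show ?thesis by blast
qed

section \<open>The rank\<close>

text \<open>The cycles \<open>twist_cycle t S\<close> with \<open>card S = k\<close> share one
  quantum degree, and the full states at \<open>base_choice S\<close> are dual to them, so the
  duality criterion counts the sets \<open>S\<close> of \<open>k\<close> blocks.\<close>

lemma rank_Kh_L_word_ge:
  assumes "t \<ge> 1"
  shows "t choose k \<le> abelian_rank (Kh_total 4 (L_word t) (int (length (L_word t)) - int k))"
proof -
  let ?F = "{S. S \<subseteq> {..<t} \<and> card S = k}" and ?i = "int (length (L_word t)) - int k"
  have less: "m \<in> S \<Longrightarrow> base_choice S m < 4" for m S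
    using base_choice by (rule twist_choices_less)
  have "card ?F \<le> abelian_rank (Kh_total 4 (L_word t) ?i)"
  proof (rule abelian_rank_Kh_total_ge[where z = "twist_cycle t" and j = "twist_degree t k"
        and x = "\<lambda>S. full_state t S (base_choice S)"])
    show "finite ?F" by simp
    show "twist_cycle t S \<in> carrier (cycle_group 4 (L_word t) ?i (twist_degree t k))" if "S \<in> ?F" for S
      using that keys_twist_cycle[of S t] differential_twist_cycle[of S t] by (simp add: carrier_cycle_group)
    show "Poly_Mapping.lookup (twist_cycle t S') (full_state t S (base_choice S)) = (if S' = S then 1 else 0)"
      if "S \<in> ?F" "S' \<in> ?F" for S S'
      using that by (intro lookup_twist_cycle) auto
    show "Poly_Mapping.lookup y (full_state t S (base_choice S)) = 0"
      if "S \<in> ?F" and y: "y \<in> boundaries 4 (L_word t) ?i (twist_degree t k)" for S y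
    proof -
      from y obtain y' where y': "y = differential 4 (L_word t) y'"
        and "y' \<in> carrier (chain_group 4 (L_word t) (?i - 1) (twist_degree t k))"
        by (auto simp: boundaries_def)
      then have "Poly_Mapping.keys y' \<subseteq> states 4 (L_word t)" by (auto simp: chain_group_def)
      with less assms show ?thesis unfolding y' by (rule lookup_differential_full_state)
    qed
  qed
  then show ?thesis by (simp add: n_subsets)
qed

theorem proposition1p6:
  fixes k :: nat
  shows "\<exists>\<epsilon>::real. \<epsilon> > 0 \<and>
    liminf (\<lambda>t. ereal (real (abelian_rank (Kh_total 4 (L_word t) (int (length (L_word t)) - int k)))
                     / real (length (L_word t) choose (length (L_word t) - k)))) \<ge> ereal \<epsilon>"
proof (intro exI conjI)
  \<comment> \<open>The quotient of the lower bound \<open>(t / k) ^ k\<close> for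
    \<open>t choose k\<close> by the upper bound \<open>(8 * t) ^ k\<close> for the denominator,
    where \<open>6 * t + 2 \<le> 8 * t\<close> since \<open>t \<ge> 1\<close>.\<close>
  let ?\<epsilon> = "(1 / (8 * real k)) ^ k"
  \<comment> \<open>For \<open>k = 0\<close> the base is 0, because division by zero gives 0, and
    \<open>0 ^ 0 = 1\<close>.\<close>
  show "?\<epsilon> > 0" by (cases "k = 0") simp_all
  show "ereal ?\<epsilon> \<le> liminf (\<lambda>t. ereal (real (abelian_rank (Kh_total 4 (L_word t) (int (length (L_word t)) - int k)))
                     / real (length (L_word t) choose (length (L_word t) - k))))"
  \<comment> \<open>\<open>t \<ge> 1\<close> is for the rank bound and \<open>k \<le> t\<close> for
    the lower estimate of \<open>t choose k\<close>; the latter also gives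
    \<open>k \<le> 6 * t + 2\<close>, so the subtraction in the denominator is not
    truncated.\<close>
  proof (intro Liminf_bounded eventually_sequentiallyI[of "max 1 k"])
    fix t assume "max 1 k \<le> t"
    then have t: "t \<ge> 1" "k \<le> t" by auto
    let ?n = "length (L_word t)"
    have n: "?n = 6 * t + 2" by (rule length_L_word)
    have "?n choose (?n - k) = ?n choose k" using t by (intro binomial_symmetric[symmetric]) (simp add: n)
    also have "\<dots> \<le> ?n ^ k" using t by (intro binomial_le_pow) (simp add: n)
    also have "\<dots> \<le> (8 * t) ^ k" using t by (intro power_mono) (simp_all add: n)
    finally have upper: "real (?n choose (?n - k)) \<le> (8 * real t) ^ k"
      by (metis of_nat_le_iff of_nat_mult of_nat_numeral of_nat_power)
    have pos: "0 < real (?n choose (?n - k))" by (simp add: zero_less_binomial)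
    have "(real t / real k) ^ k \<le> real (t choose k)" using t(2) by (rule binomial_ge_n_over_k_pow_k)
    also have "\<dots> \<le> real (abelian_rank (Kh_total 4 (L_word t) (int ?n - int k)))"
      using rank_Kh_L_word_ge[OF t(1)] by simp
    finally have lower: "(real t / real k) ^ k \<le> real (abelian_rank (Kh_total 4 (L_word t) (int ?n - int k)))" .
    have "?\<epsilon> = (real t / real k) ^ k / (8 * real t) ^ k"
      unfolding power_divide[symmetric] using t(1) by (simp add: field_simps)
    also have "\<dots> \<le> real (abelian_rank (Kh_total 4 (L_word t) (int ?n - int k))) / real (?n choose (?n - k))"
      using lower upper pos by (intro frac_le) simp_all
    finally show "ereal ?\<epsilon> \<le> ereal (real (abelian_rank (Kh_total 4 (L_word t) (int ?n - int k)))
        / real (?n choose (?n - k)))" by simp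
  qed
qed

end
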